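(* Let $r>0$, let $(\eta_n)$ be i.i.d. with density $\frac{r^r}{\Gamma(r)}x^{r-1}e^{-rx}$ ($x>0$), and let $\lambda_n=\ell(n)n^{-\gamma}$ with $\gamma>1/2$ and $\ell$ slowly varying at $\infty$, the sequence being positive and non-increasing with $\frac1r\sum_n\lambda_n^2=1$. Let $\sigma_M^2=\frac1r\sum_{n\ge M}\lambda_n^2$, $\tilde Y_M=\sigma_M^{-1}\sum_{n=M}^\infty\lambda_n(\eta_n-1)$ and $\kappa_{k,M}=\frac{(k-1)!}{r^{k-1}\sigma_M^k}\sum_{n\ge M}\lambda_n^k$. Then for each $N\ge2$, as $M\to\infty$, $$\mathrm P[\tilde Y_M\le x]=\Phi(x)-\phi(x)\left\{\sum_{\eta(N)}\left[\prod_{m=3}^N\frac1{k_m!}\left(\frac{\kappa_{m,M}}{m!}\right)^{k_m}\right]H_{\zeta(k_3,\dots,k_N)}(x)\right\}+O\!\left(M^{-\frac{N-1}2}\right),$$ where the $O(M^{-(N-1)/2})$ term is uniform in $x\in\mathbb{R}$.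
   Context: $\Phi,\phi$ are the standard normal CDF and density. $\eta(N)$ is the set of tuples of non-negative integers $(k_3,\dots,k_N)$ with $1\le k_3+2k_4+\dots+(N-2)k_N\le N-2$ (empty for $N=2$), and $\zeta(k_3,\dots,k_N)=3k_3+4k_4+\dots+Nk_N-1$. $H_k$ are the Hermite polynomials $H_0=1$, $H_k(x)=(-1)^ke^{x^2/2}\frac{d^k}{dx^k}e^{-x^2/2}$ (so $H_1=x$, $H_2=x^2-1$, $H_3=x^3-3x,\dots$). *)

theory Defs
  imports "HOL-Probability.Probability"
begin

definition Phi :: "real \<Rightarrow> real" where
  "Phi x = cdf std_normal_distribution x"

definition phi :: "real \<Rightarrow> real" where
  "phi x = std_normal_density x"

definition hermite :: "nat \<Rightarrow> real \<Rightarrow> real" where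
  "hermite k x = (-1) ^ k * exp (x\<^sup>2 / 2) * (deriv ^^ k) (\<lambda>t. exp (- t\<^sup>2 / 2)) x"

definition slowly_varying :: "(real \<Rightarrow> real) \<Rightarrow> bool" where
  "slowly_varying l \<longleftrightarrow> l \<in> borel_measurable borel \<and> (\<forall>\<^sub>F x in at_top. l x > 0) \<and>
     (\<forall>c>0. ((\<lambda>x. l (c * x) / l x) \<longlongrightarrow> 1) at_top)"

definition gamma_dens :: "real \<Rightarrow> real \<Rightarrow> real" where
  "gamma_dens r x = (if x > 0 then r powr r / Gamma r * x powr (r - 1) * exp (- r * x) else 0)"

text \<open>The index set eta(N): tuples (k_3,...,k_N), represented as functions nat => nat
  vanishing outside {3..N}.\<close>
definition eta_set :: "nat \<Rightarrow> (nat \<Rightarrow> nat) set" where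
  "eta_set N = {k. (\<forall>m. m \<notin> {3..N} \<longrightarrow> k m = 0) \<and>
      1 \<le> (\<Sum>m=3..N. (m - 2) * k m) \<and> (\<Sum>m=3..N. (m - 2) * k m) \<le> N - 2}"

definition zeta :: "nat \<Rightarrow> (nat \<Rightarrow> nat) \<Rightarrow> nat" where
  "zeta N k = (\<Sum>m=3..N. m * k m) - 1"

definition sigma2 :: "real \<Rightarrow> (nat \<Rightarrow> real) \<Rightarrow> nat \<Rightarrow> real" where
  "sigma2 r lam M = (1 / r) * (\<Sum>n. (lam (n + M))\<^sup>2)"

definition sigma :: "real \<Rightarrow> (nat \<Rightarrow> real) \<Rightarrow> nat \<Rightarrow> real" where
  "sigma r lam M = sqrt (sigma2 r lam M)"

definition kappa :: "real \<Rightarrow> (nat \<Rightarrow> real) \<Rightarrow> nat \<Rightarrow> nat \<Rightarrow> real" where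
  "kappa r lam k M = fact (k - 1) / (r ^ (k - 1) * sigma r lam M ^ k) * (\<Sum>n. lam (n + M) ^ k)"

definition Ytil :: "real \<Rightarrow> (nat \<Rightarrow> real) \<Rightarrow> (nat \<Rightarrow> 'a \<Rightarrow> real) \<Rightarrow> nat \<Rightarrow> 'a \<Rightarrow> real" where
  "Ytil r lam eta M \<omega> = (\<Sum>n. lam (n + M) * (eta (n + M) \<omega> - 1)) / sigma r lam M"

definition edgeworth :: "real \<Rightarrow> (nat \<Rightarrow> real) \<Rightarrow> nat \<Rightarrow> nat \<Rightarrow> real \<Rightarrow> real" where
  "edgeworth r lam N M x = Phi x - phi x *
     (\<Sum>k\<in>eta_set N. (\<Prod>m=3..N. (1 / fact (k m)) * (kappa r lam m M / fact m) ^ k m)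
        * hermite (zeta N k) x)"

end

theory Submission
  imports Defs "HOL-Real_Asymp.Real_Asymp"
begin

text \<open>
  Put \<open>a n = lam (n + M) / (r * sigma M)\<close>, so that \<open>r * (\<Sum>n. (a n)\<^sup>2) = 1\<close>, and \<open>\<epsilon> = a 0\<close>, the largest
  weight. By Kolmogorov's theorem the series converges almost surely, hence the characteristic function
  of the standardized tail is \<open>\<psi> t = (\<Prod>n. (1 - \<i> t a n) powr - r * exp (- \<i> t r a n))\<close>.
  If \<open>3 \<epsilon> \<bar>t\<bar> \<le> 1\<close>, expanding the logarithm to order \<open>N\<close> and then the exponential of the cubic and
  higher terms, sorted by weight, shows that \<open>\<psi>\<close> differs from the Fourier transform of the Edgeworth
  expansion by \<open>O((\<epsilon> \<bar>t\<bar>) ^ (N - 1) (1 + t\<^sup>2) exp (- t\<^sup>2 / 6))\<close>. If \<open>3 \<epsilon> \<bar>t\<bar> > 1\<close>, the expansion is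
  negligible, and \<open>\<psi>\<close> is exponentially small in \<open>M\<close> because by slow variation
  the first \<open>M\<close> weights are comparable to \<open>\<epsilon>\<close>. This comparability and the normalization also give
  \<open>\<epsilon> = O(M powr (- 1 / 2))\<close>. Levy's inversion formula turns the bound
  for \<open>\<bar>\<psi> t - \<dots>\<bar> / \<bar>t\<bar>\<close>, which is integrable, into a uniform bound for the distribution function.
\<close>

section \<open>Kolmogorov's convergence theorem\<close>

text \<open>Gamma variables have characteristic functions that decay like a power of t. A product of
  K of them with r K \<ge> 2 and weights bounded below is O(1 / t^2), so the error of the transforms
  is integrable on the whole line after division by |t|. Neither a cutoff nor a smoothing kernel is
  needed in the inversion, and arbitrarily small r is compensated by taking many factors. The order
  of the error comes from counting powers of \<open>\<epsilon>\<close>. The cumulant of order m is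
  O(\<open>\<epsilon>\<close> ^ (m - 2)), so a tuple k contributes with weight \<Sum> (m - 2) * k m.
  The set \<open>eta_set N\<close> keeps the positive weights up to N - 2, and the first omitted
  weight is N - 1. The number 3 in the threshold 3 \<open>\<epsilon>\<close> |t| \<le> 1 is a
  budget: the cubic and higher terms are then at most t^2 / 6, and so is the remainder of the
  logarithm, so that exp (- t^2 / 2) exp (t^2 / 3) = exp (- t^2 / 6) is left over for
  integrability.\<close>

lemma (in prob_space) kolmogorov_maximal_inequality:
  fixes X :: "nat \<Rightarrow> 'a \<Rightarrow> real"
  assumes indep: "indep_vars (\<lambda>_. borel) X UNIV"
    and sq: "\<And>i. integrable M (\<lambda>\<omega>. (X i \<omega>)\<^sup>2)"
    and mean: "\<And>i. expectation (X i) = 0"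
    and e: "e > 0"
  shows "prob {\<omega>\<in>space M. \<exists>k\<le>n. e \<le> \<bar>\<Sum>i<k. X i \<omega>\<bar>} \<le> (\<Sum>i<n. expectation (\<lambda>\<omega>. (X i \<omega>)\<^sup>2)) / e\<^sup>2"
proof -
  have X[measurable]: "X i \<in> borel_measurable M" for i
    using indep by (auto simp: indep_vars_def)
  have Xint: "integrable M (X i)" for i
    by (rule square_integrable_imp_integrable[OF X sq])
  define g :: "nat \<Rightarrow> (nat \<Rightarrow> real) \<Rightarrow> real"
    where "g k x = (if \<forall>j\<in>{..k}. \<bar>\<Sum>i<j. x i\<bar> < e then 1 else 0)" for k x
  \<comment> \<open>the partial sums stopped at the first exit from the interval \<open>(-e, e)\<close>\<close>
  define D where "D k x = (\<Sum>i<k. g i x * x i)" for k x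
  have g_cong: "g k x = g k y" if "\<And>i. i < k \<Longrightarrow> x i = y i" for k x y
  proof -
    have "(\<Sum>i<j. x i) = (\<Sum>i<j. y i)" if "j \<in> {..k}" for j
      using that \<open>\<And>i. i < k \<Longrightarrow> x i = y i\<close> by (intro sum.cong) auto
    then show ?thesis by (simp add: g_def)
  qed
  have D_cong: "D k x = D k y" if "\<And>i. i < k \<Longrightarrow> x i = y i" for k x y
    unfolding D_def using that by (intro sum.cong arg_cong2[where f="(*)"] g_cong) auto
  have g_meas: "g k \<in> borel_measurable (PiM {..<n} (\<lambda>_. borel))" if "k \<le> n" for k n
  proof -
    have [measurable]: "(\<lambda>x. \<Sum>i<j. x i) \<in> borel_measurable (PiM {..<n} (\<lambda>_. borel :: real measure))"
      if "j \<le> n" for j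
      using that by (intro borel_measurable_sum measurable_component_singleton) auto
    have "Measurable.pred (PiM {..<n} (\<lambda>_. borel :: real measure)) (\<lambda>x. \<forall>j\<in>{..k}. \<bar>\<Sum>i<j. x i\<bar> < e)"
      using that by (intro pred_intros_finite) auto
    then show ?thesis unfolding g_def by measurable
  qed
  have D_meas: "D k \<in> borel_measurable (PiM {..<n} (\<lambda>_. borel))" if "k \<le> n" for k n
    unfolding D_def using that
    by (intro borel_measurable_sum borel_measurable_times g_meas measurable_component_singleton) auto
  \<comment> \<open>Independence of blocks is stated for restricted families, so \<open>g k\<close>
    and \<open>D k\<close> have to be rewritten as functions of the coordinates below k.\<close>
  let ?R = "\<lambda>n \<omega>. restrict (\<lambda>i. X i \<omega>) {..<n}"
  have R[measurable]: "?R n \<in> measurable M (PiM {..<n} (\<lambda>_. borel))" for n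
    by (intro measurable_restrict X)
  have gR: "g k (\<lambda>i. X i \<omega>) = g k (?R k \<omega>)" for k \<omega> by (rule g_cong) auto
  have DR: "D k (\<lambda>i. X i \<omega>) = D k (?R k \<omega>)" for k \<omega> by (rule D_cong) auto
  have [measurable]: "(\<lambda>\<omega>. g k (\<lambda>i. X i \<omega>)) \<in> borel_measurable M"
    "(\<lambda>\<omega>. D k (\<lambda>i. X i \<omega>)) \<in> borel_measurable M" for k
    unfolding gR DR using measurable_compose[OF R g_meas[of k k]] measurable_compose[OF R D_meas[of k k]] by auto
  \<comment> \<open>\<open>D k * g k\<close> is determined by the coordinates below k, hence
    independent of the centred \<open>X k\<close>. The increments of the stopped sum are therefore
    orthogonal and its second moments simply add up.\<close>
  have cross: "integrable M (\<lambda>\<omega>. D k (\<lambda>i. X i \<omega>) * g k (\<lambda>i. X i \<omega>) * X k \<omega>)"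
    "expectation (\<lambda>\<omega>. D k (\<lambda>i. X i \<omega>) * g k (\<lambda>i. X i \<omega>) * X k \<omega>) = 0"
    if "integrable M (\<lambda>\<omega>. (D k (\<lambda>i. X i \<omega>))\<^sup>2)" for k
  proof -
    have "indep_var (PiM {..<k} (\<lambda>_. borel)) (?R k) (PiM {k} (\<lambda>_. borel)) (\<lambda>\<omega>. restrict (\<lambda>i. X i \<omega>) {k})"
      by (rule indep_var_restrict[OF indep]) auto
    from indep_var_compose[OF this, of "\<lambda>x. D k x * g k x" borel "\<lambda>x. x k" borel]
    have iv: "indep_var borel (\<lambda>\<omega>. D k (\<lambda>i. X i \<omega>) * g k (\<lambda>i. X i \<omega>)) borel (X k)"
      unfolding DR gR using borel_measurable_times[OF D_meas[of k k] g_meas[of k k]]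
      by (simp add: comp_def)
    have Dint: "integrable M (\<lambda>\<omega>. D k (\<lambda>i. X i \<omega>))"
      by (rule square_integrable_imp_integrable[OF _ that]) auto
    have i1: "integrable M (\<lambda>\<omega>. D k (\<lambda>i. X i \<omega>) * g k (\<lambda>i. X i \<omega>))"
      by (rule Bochner_Integration.integrable_bound[OF Dint]) (auto simp: g_def)
    show "integrable M (\<lambda>\<omega>. D k (\<lambda>i. X i \<omega>) * g k (\<lambda>i. X i \<omega>) * X k \<omega>)"
      by (rule indep_var_integrable[OF iv i1 Xint])
    show "expectation (\<lambda>\<omega>. D k (\<lambda>i. X i \<omega>) * g k (\<lambda>i. X i \<omega>) * X k \<omega>) = 0"
      by (subst indep_var_lebesgue_integral[OF iv i1 Xint]) (simp add: mean)
  qed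
  have main: "integrable M (\<lambda>\<omega>. (D k (\<lambda>i. X i \<omega>))\<^sup>2) \<and>
      expectation (\<lambda>\<omega>. (D k (\<lambda>i. X i \<omega>))\<^sup>2) \<le> (\<Sum>i<k. expectation (\<lambda>\<omega>. (X i \<omega>)\<^sup>2))" for k
  proof (induction k)
    case 0 show ?case by (simp add: D_def)
  next
    case (Suc k)
    have gsq: "g k x * g k x = g k x" for x by (simp add: g_def)
    have eq: "(D (Suc k) x)\<^sup>2 = (D k x)\<^sup>2 + 2 * (D k x * g k x * x k) + g k x * (x k)\<^sup>2" for x
    proof -
      have "(D (Suc k) x)\<^sup>2 = (D k x)\<^sup>2 + 2 * (D k x * g k x * x k) + (g k x * g k x) * (x k)\<^sup>2"
        by (simp add: D_def power2_eq_square algebra_simps)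
      then show ?thesis by (simp add: gsq)
    qed
    have ig: "integrable M (\<lambda>\<omega>. g k (\<lambda>i. X i \<omega>) * (X k \<omega>)\<^sup>2)"
      by (rule Bochner_Integration.integrable_bound[OF sq[of k]]) (auto simp: g_def)
    have "expectation (\<lambda>\<omega>. g k (\<lambda>i. X i \<omega>) * (X k \<omega>)\<^sup>2) \<le> expectation (\<lambda>\<omega>. (X k \<omega>)\<^sup>2)"
      by (rule integral_mono[OF ig sq]) (auto simp: g_def)
    then show ?case
      unfolding eq using Suc cross[of k] ig by (auto simp del: mult_eq_0_iff)
  qed
  \<comment> \<open>From the first exit on, all factors \<open>g j\<close> vanish, so
    \<open>D n\<close> keeps the value of the partial sum that left the interval. A second moment of
    \<open>D n\<close> alone thus controls the maximum.\<close>
  have stop: "e \<le> \<bar>D n x\<bar>" if "\<exists>k\<le>n. e \<le> \<bar>\<Sum>i<k. x i\<bar>" for x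
  proof -
    define k where "k = (LEAST k. e \<le> \<bar>\<Sum>i<k. x i\<bar>)"
    have k: "e \<le> \<bar>\<Sum>i<k. x i\<bar>" "\<And>j. j < k \<Longrightarrow> \<bar>\<Sum>i<j. x i\<bar> < e"
      unfolding k_def using that LeastI_ex[of "\<lambda>k. e \<le> \<bar>\<Sum>i<k. x i\<bar>"] not_less_Least[of _ "\<lambda>k. e \<le> \<bar>\<Sum>i<k. x i\<bar>"]
      by (auto simp: not_le)
    have "k \<le> n" unfolding k_def using that by (meson Least_le le_trans)
    have gk: "g j x = (if j < k then 1 else 0)" for j
    proof (cases "j < k")
      case True then show ?thesis using k(2) by (auto simp: g_def)
    next
      case False
      then have "\<not> (\<forall>j'\<in>{..j}. \<bar>\<Sum>i<j'. x i\<bar> < e)"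
        using k(1) by (intro notI) (drule bspec[of _ _ k], auto)
      then show ?thesis using False unfolding g_def by (simp only: if_False)
    qed
    have "D n x = (\<Sum>i\<in>{..<n}. if i \<in> {..<k} then x i else 0)"
      unfolding D_def gk by (intro sum.cong) auto
    also have "\<dots> = (\<Sum>i<k. x i)"
      by (subst sum.inter_restrict[symmetric]) (use \<open>k \<le> n\<close> in \<open>auto intro!: sum.cong\<close>)
    finally show ?thesis using k by simp
  qed
  have "prob {\<omega>\<in>space M. \<exists>k\<le>n. e \<le> \<bar>\<Sum>i<k. X i \<omega>\<bar>} \<le> prob {\<omega>\<in>space M. e\<^sup>2 \<le> (D n (\<lambda>i. X i \<omega>))\<^sup>2}"
  proof (rule finite_measure_mono)
    have "e\<^sup>2 \<le> (D n x)\<^sup>2" if "\<exists>k\<le>n. e \<le> \<bar>\<Sum>i<k. x i\<bar>" for x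
      using stop[OF that] e abs_le_square_iff[of e "D n x"] by auto
    then show "{\<omega>\<in>space M. \<exists>k\<le>n. e \<le> \<bar>\<Sum>i<k. X i \<omega>\<bar>} \<subseteq> {\<omega>\<in>space M. e\<^sup>2 \<le> (D n (\<lambda>i. X i \<omega>))\<^sup>2}"
      by blast
  qed measurable
  also have "\<dots> \<le> expectation (\<lambda>\<omega>. (D n (\<lambda>i. X i \<omega>))\<^sup>2) / e\<^sup>2"
    by (rule integral_Markov_inequality_measure[where A="{}"]) (use main e in auto)
  also have "\<dots> \<le> (\<Sum>i<n. expectation (\<lambda>\<omega>. (X i \<omega>)\<^sup>2)) / e\<^sup>2"
    using main e by (intro divide_right_mono) auto
  finally show ?thesis .
qed

text \<open>Disjoint singleton blocks of an independent family are independent; reading off the only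
  coordinate of each block reindexes the family.\<close>

lemma (in prob_space) indep_vars_shift:
  fixes X :: "nat \<Rightarrow> 'a \<Rightarrow> real"
  assumes indep: "indep_vars (\<lambda>_. borel) X I" and I: "\<And>i. i + m \<in> I"
  shows "indep_vars (\<lambda>_. borel) (\<lambda>i. X (i + m)) UNIV"
proof -
  have "indep_vars (\<lambda>j. PiM {j + m} (\<lambda>_. borel)) (\<lambda>j \<omega>. restrict (\<lambda>i. X i \<omega>) {j + m}) UNIV"
    using I by (intro indep_vars_restrict[OF indep]) (auto simp: disjoint_family_on_def)
  from indep_vars_compose2[OF this, of "\<lambda>j f. f (j + m)" "\<lambda>_. borel"]
  show ?thesis by simp
qed

text \<open>The partial sums started at m leave (-e, e) with probability at most the tail variance
  over e^2, which tends to 0 as m grows. So almost surely, for each e, some start m keeps all of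
  them inside, and this is the Cauchy property.\<close>

lemma (in prob_space) kolmogorov_summable_AE:
  fixes X :: "nat \<Rightarrow> 'a \<Rightarrow> real"
  assumes indep: "indep_vars (\<lambda>_. borel) X UNIV"
    and sq: "\<And>i. integrable M (\<lambda>\<omega>. (X i \<omega>)\<^sup>2)"
    and mean: "\<And>i. expectation (X i) = 0"
    and var: "summable (\<lambda>i. expectation (\<lambda>\<omega>. (X i \<omega>)\<^sup>2))"
  shows "AE \<omega> in M. summable (\<lambda>i. X i \<omega>)"
proof -
  let ?v = "\<lambda>i. expectation (\<lambda>\<omega>. (X i \<omega>)\<^sup>2)"
  have X[measurable]: "X i \<in> borel_measurable M" for i
    using indep by (auto simp: indep_vars_def)
  define B where "B e m = {\<omega>\<in>space M. \<exists>k. e \<le> \<bar>\<Sum>i<k. X (i + m) \<omega>\<bar>}" for e :: real and m :: nat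
  have [measurable]: "B e m \<in> events" for e m unfolding B_def by measurable
  have prob_B: "prob (B e m) \<le> (\<Sum>i. ?v (i + m)) / e\<^sup>2" if e: "e > 0" for e m
  proof -
    have "indep_vars (\<lambda>_. borel) (\<lambda>i. X (i + m)) UNIV"
      by (rule indep_vars_shift[OF indep]) auto
    from kolmogorov_maximal_inequality[OF this sq mean e]
    have 1: "prob {\<omega>\<in>space M. \<exists>k\<le>n. e \<le> \<bar>\<Sum>i<k. X (i + m) \<omega>\<bar>} \<le> (\<Sum>i. ?v (i + m)) / e\<^sup>2" for n
    proof (rule order_trans)
      show "(\<Sum>i<n. ?v (i + m)) / e\<^sup>2 \<le> (\<Sum>i. ?v (i + m)) / e\<^sup>2"
        using var e by (intro divide_right_mono sum_le_suminf) (auto intro: summable_ignore_initial_segment[of ?v])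
    qed
    \<comment> \<open>Continuity from below removes the finite horizon of the maximal
      inequality.\<close>
    have "(\<lambda>n. prob {\<omega>\<in>space M. \<exists>k\<le>n. e \<le> \<bar>\<Sum>i<k. X (i + m) \<omega>\<bar>})
        \<longlonglongrightarrow> prob (\<Union>n. {\<omega>\<in>space M. \<exists>k\<le>n. e \<le> \<bar>\<Sum>i<k. X (i + m) \<omega>\<bar>})"
      by (rule finite_Lim_measure_incseq) (auto simp: incseq_def intro: order_trans)
    also have "(\<Union>n. {\<omega>\<in>space M. \<exists>k\<le>n. e \<le> \<bar>\<Sum>i<k. X (i + m) \<omega>\<bar>}) = B e m"
      by (auto simp: B_def)
    finally show ?thesis by (rule LIMSEQ_le_const2) (use 1 in auto)
  qed
  have AE_B: "AE \<omega> in M. \<exists>m. \<omega> \<notin> B e m" if e: "e > 0" for e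
  proof -
    have "prob (\<Inter>m. B e m) \<le> (\<Sum>i. ?v (i + m)) / e\<^sup>2" for m
      by (rule order_trans[OF finite_measure_mono prob_B[OF e, of m]]) auto
    moreover have "(\<lambda>m. (\<Sum>i. ?v (i + m)) / e\<^sup>2) \<longlonglongrightarrow> 0 / e\<^sup>2"
      by (intro tendsto_divide suminf_exist_split2 var) (use e in auto)
    ultimately have "prob (\<Inter>m. B e m) \<le> 0 / e\<^sup>2"
      by (intro LIMSEQ_le_const) auto
    then have "prob (\<Inter>m. B e m) = 0" by (simp add: measure_le_0_iff)
    then have "AE \<omega> in M. \<omega> \<notin> (\<Inter>m. B e m)" by (subst (asm) prob_eq_0) auto
    then show ?thesis by simp
  qed
  have "AE \<omega> in M. \<forall>j. \<exists>m. \<omega> \<notin> B (inverse (real (Suc j))) m"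
    by (subst AE_all_countable) (auto intro!: AE_B)
  moreover have "AE \<omega> in M. \<omega> \<in> space M" by simp
  ultimately show ?thesis
  proof eventually_elim
    case (elim \<omega>)
    show ?case
    proof (rule summable_Cauchy[THEN iffD2], intro allI impI)
      fix e :: real assume "e > 0"
      \<comment> \<open>Half of e, because a block from p to q is the difference of two sums started
        at m.\<close>
      then obtain j where j: "inverse (real (Suc j)) < e / 2"
        using reals_Archimedean[of "e/2"] by auto
      obtain m where "\<omega> \<notin> B (inverse (real (Suc j))) m" using elim by blast
      with elim have "\<bar>\<Sum>i<k. X (i + m) \<omega>\<bar> < inverse (real (Suc j))" for k
        by (auto simp: B_def not_le)
      from less_trans[OF this j] have m: "\<bar>\<Sum>i<k. X (i + m) \<omega>\<bar> < e / 2" for k .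
      have sh: "(\<Sum>i=m..<p. X i \<omega>) = (\<Sum>i<p-m. X (i + m) \<omega>)" if "p \<ge> m" for p
        using that sum.shift_bounds_nat_ivl[of "\<lambda>i. X i \<omega>" 0 m "p - m"] by (simp add: atLeast0LessThan)
      have "norm (\<Sum>i=p..<q. X i \<omega>) < e" if "p \<ge> m" for p q
      proof (cases "p \<le> q")
        case True
        have "(\<Sum>i=p..<q. X i \<omega>) = (\<Sum>i=m..<q. X i \<omega>) - (\<Sum>i=m..<p. X i \<omega>)"
          using that True sum.atLeastLessThan_concat[of m p q "\<lambda>i. X i \<omega>"] by simp
        also have "\<bar>\<dots>\<bar> < e"
          using m[of "q - m"] m[of "p - m"] that True unfolding sh[OF that] by (subst sh) auto
        finally show ?thesis by simp
      qed (use \<open>e > 0\<close> in auto)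
      then show "\<exists>N. \<forall>m\<ge>N. \<forall>n. norm (sum (\<lambda>i. X i \<omega>) {m..<n}) < e" by blast
    qed
  qed
qed

section \<open>Characteristic function of the gamma distribution\<close>

text \<open>Differentiation under the integral sign, used for the gamma density and for the
  Gaussian. The difference quotients are dominated by 2 |x f x|; the second-order bound serves for
  pointwise convergence only, so that x^2 f need not be integrable.\<close>

lemma has_vector_derivative_fourier:
  fixes f :: "real \<Rightarrow> complex"
  assumes f: "integrable lborel f" and xf: "integrable lborel (\<lambda>x. of_real x * f x)"
  shows "((\<lambda>t. LINT x|lborel. iexp (t * x) * f x) has_vector_derivative
           (LINT x|lborel. \<i> * of_real x * iexp (t * x) * f x)) (at t)"
proof -
  have [measurable]: "f \<in> borel_measurable borel" using f by auto
  have i1: "integrable lborel (\<lambda>x. iexp (t * x) * f x)" for t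
    by (rule Bochner_Integration.integrable_bound[OF f]) (auto simp: norm_mult)
  have i2: "integrable lborel (\<lambda>x. \<i> * of_real x * iexp (t * x) * f x)" for t
    by (rule Bochner_Integration.integrable_bound[OF xf]) (auto simp: norm_mult)
  let ?F = "\<lambda>t. LINT x|lborel. iexp (t * x) * f x"
  let ?D = "LINT x|lborel. \<i> * of_real x * iexp (t * x) * f x"
  let ?s = "\<lambda>h x. (iexp ((t + h) * x) * f x - iexp (t * x) * f x - of_real h * (\<i> * of_real x * iexp (t * x) * f x)) / of_real h"
  have s_eq: "?s h x = iexp (t * x) * f x * ((iexp (h * x) - 1 - \<i> * of_real (h * x)) / of_real h)" for h x
    by (simp add: algebra_simps exp_add diff_divide_distrib add_divide_distrib)
  have s_norm: "norm (?s h x) = norm (f x) * (cmod (iexp (h * x) - 1 - \<i> * of_real (h * x)) / \<bar>h\<bar>)" for h x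
    unfolding s_eq norm_mult norm_divide norm_exp_i_times norm_of_real by simp
  have lim: "(\<lambda>h. norm (?F (t + h) - ?F t - h *\<^sub>R ?D) / norm h) \<midarrow>0\<rightarrow> 0"
    unfolding tendsto_at_iff_sequentially comp_def
  proof (intro allI impI)
    fix h :: "nat \<Rightarrow> real" assume h0: "\<forall>i. h i \<in> UNIV - {0}" and h: "h \<longlonglongrightarrow> 0"
    have "(\<lambda>n. LINT x|lborel. ?s (h n) x) \<longlonglongrightarrow> (LINT x::real|lborel. 0 :: complex)"
    proof (rule integral_dominated_convergence[where w="\<lambda>x. 2 * norm (of_real x * f x)"])
      show "integrable lborel (\<lambda>x. 2 * norm (of_real x * f x))" using xf by auto
      show "AE x in lborel. (\<lambda>n. ?s (h n) x) \<longlonglongrightarrow> 0"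
      proof (rule AE_I2, rule Lim_null_comparison, rule always_eventually, rule allI)
        fix x n
        have "cmod (iexp (h n * x) - 1 - \<i> * of_real (h n * x)) \<le> \<bar>h n * x\<bar>\<^sup>2 / 2"
          using iexp_approx1[of "h n * x" 1] by (simp add: algebra_simps power2_eq_square)
        also have "\<dots> \<le> \<bar>h n * x\<bar>\<^sup>2" by simp
        also have "\<dots> = \<bar>h n\<bar> * (\<bar>h n\<bar> * x\<^sup>2)"
          by (simp add: abs_mult power_mult_distrib power2_eq_square[of "h n"] flip: mult.assoc)
        finally have "cmod (iexp (h n * x) - 1 - \<i> * of_real (h n * x)) / \<bar>h n\<bar> \<le> \<bar>h n\<bar> * x\<^sup>2"
          using h0 by (subst pos_divide_le_eq) (auto simp: mult.commute)
        then show "norm (?s (h n) x) \<le> norm (f x) * (\<bar>h n\<bar> * x\<^sup>2)"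
          unfolding s_norm by (rule mult_left_mono) simp
      next
        fix x
        have "(\<lambda>n. norm (f x) * (\<bar>h n\<bar> * x\<^sup>2)) \<longlonglongrightarrow> norm (f x) * (\<bar>0\<bar> * x\<^sup>2)"
          by (intro tendsto_intros h)
        then show "(\<lambda>n. norm (f x) * (\<bar>h n\<bar> * x\<^sup>2)) \<longlonglongrightarrow> 0" by simp
      qed
      show "AE x in lborel. norm (?s (h n) x) \<le> 2 * norm (of_real x * f x)" for n
      proof (intro AE_I2)
        fix x
        have "cmod (iexp (h n * x) - 1 - \<i> * of_real (h n * x)) \<le> cmod (iexp (h n * x) - 1) + cmod (\<i> * of_real (h n * x))"
          by (rule norm_triangle_ineq4)
        also have "\<dots> \<le> \<bar>h n * x\<bar> + \<bar>h n * x\<bar>"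
          using iexp_approx1[of "h n * x" 0] by (intro add_mono) (auto simp: norm_mult)
        also have "\<dots> = 2 * \<bar>x\<bar> * \<bar>h n\<bar>" by (simp add: abs_mult)
        finally have "cmod (iexp (h n * x) - 1 - \<i> * of_real (h n * x)) / \<bar>h n\<bar> \<le> 2 * \<bar>x\<bar>"
          using h0 by (subst pos_divide_le_eq) auto
        then have "norm (?s (h n) x) \<le> norm (f x) * (2 * \<bar>x\<bar>)"
          unfolding s_norm by (rule mult_left_mono) simp
        then show "norm (?s (h n) x) \<le> 2 * norm (of_real x * f x)" by (simp only: norm_mult norm_of_real mult_ac)
      qed
    qed auto
    then have "(\<lambda>n. norm (LINT x|lborel. ?s (h n) x)) \<longlonglongrightarrow> 0" using tendsto_norm_zero by auto
    also have "(LINT x|lborel. ?s (h n) x) = (?F (t + h n) - ?F t - of_real (h n) * ?D) / of_real (h n)" for n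
      by (simp only: integral_divide_zero Bochner_Integration.integral_diff integral_mult_right_zero i1 i2
          Bochner_Integration.integrable_diff integrable_mult_right)
    then have "(\<lambda>n. norm (LINT x|lborel. ?s (h n) x)) = (\<lambda>n. norm (?F (t + h n) - ?F t - h n *\<^sub>R ?D) / norm (h n))"
      by (simp only: norm_divide scaleR_conv_of_real norm_of_real real_norm_def)
    finally show "(\<lambda>n. norm (?F (t + h n) - ?F t - h n *\<^sub>R ?D) / norm (h n)) \<longlonglongrightarrow> 0" .
  qed
  show ?thesis
    unfolding has_vector_derivative_def has_derivative_at
    using lim by (auto intro: bounded_linear_scaleR_left)
qed

text \<open>The norm of the integrand sees only the real part of w, so a Gamma integral with real
  rate dominates it.\<close>

lemma powr_exp_set_integrable:
  fixes w :: complex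
  assumes s: "s > 0" and w: "Re w > 0"
  shows "set_integrable lborel {0<..} (\<lambda>x::real. of_real (x powr (s - 1)) * exp (- (w * of_real x)))"
proof -
  have "(\<lambda>t. complex_of_real t powr (of_real s - 1) / of_real (exp (Re w * t))) absolutely_integrable_on {0<..}"
    using s w by (intro absolutely_integrable_Gamma_integral) auto
  then have i: "integrable lebesgue (\<lambda>t. norm (indicator {0<..} t *\<^sub>R (complex_of_real t powr (of_real s - 1) / of_real (exp (Re w * t)))))"
    unfolding set_integrable_def by (rule integrable_norm)
  have eq: "norm (indicator {0<..} t *\<^sub>R (complex_of_real t powr (of_real s - 1) / of_real (exp (Re w * t))))
     = indicator {0<..} t * (t powr (s - 1) * exp (- (Re w * t)))" for t :: real
    by (auto simp: norm_divide norm_powr_real_powr exp_minus field_simps indicator_def)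
  have "integrable lborel (\<lambda>t::real. indicator {0<..} t * (t powr (s - 1) * exp (- (Re w * t))))"
    using i unfolding eq by (subst (asm) integrable_completion) auto
  then show ?thesis unfolding set_integrable_def
    by (rule Bochner_Integration.integrable_bound) (auto simp: norm_mult indicator_def)
qed

text \<open>Integration by parts: the derivative of x^s exp (- w x) integrates to zero over (0,
  \<infinity>), since both boundary values vanish for s > 0 and Re w > 0. For w = 1 this is the
  functional equation of Gamma.\<close>

lemma powr_exp_integral_Suc:
  fixes w :: complex
  assumes s: "s > 0" and w: "Re w > 0"
  shows "w * (LINT x:{0<..}|lborel. of_real (x powr s) * exp (- (w * of_real x)))
       = of_real s * (LINT x:{0<..}|lborel. of_real (x powr (s - 1)) * exp (- (w * of_real x)))"
proof -
  let ?F = "\<lambda>x::real. of_real (x powr s) * exp (- (w * of_real x))"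
  let ?G = "\<lambda>x::real. of_real (x powr (s - 1)) * exp (- (w * of_real x))"
  have iF: "set_integrable lborel {0<..} ?F" using powr_exp_set_integrable[of "s+1" w] s w by simp
  have iG: "set_integrable lborel {0<..} ?G" by (rule powr_exp_set_integrable[OF s w])
  have nF: "norm (?F x) = x powr s * exp (- (Re w * x))" for x by (simp add: norm_mult)
  have "(LBINT x=0..\<infinity>. of_real s * ?G x - w * ?F x) = 0 - (0::complex)"
  proof (rule interval_integral_FTC_integrable)
    show "(?F has_vector_derivative of_real s * ?G x - w * ?F x) (at x)" if "0 < ereal x" for x
    proof -
      have x: "x > 0" using that by simp
      have 1: "((\<lambda>x. x powr s) has_real_derivative (s * x powr (s - 1))) (at x)"
        by (rule has_real_derivative_powr[OF x])
      have 2: "((\<lambda>x. exp (- (w * of_real x))) has_vector_derivative (- w * exp (- (w * of_real x)))) (at x)"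
        by (rule has_vector_derivative_real_field)
           (auto intro!: derivative_eq_intros)
      show ?thesis
        using has_vector_derivative_mult[OF has_vector_derivative_of_real[OF 1] 2]
        by (simp add: algebra_simps)
    qed
    show "isCont (\<lambda>x. of_real s * ?G x - w * ?F x) x" if "0 < ereal x" for x
      using that by (auto intro!: continuous_intros)
    show "set_integrable lborel (einterval 0 \<infinity>) (\<lambda>x. of_real s * ?G x - w * ?F x)"
      using set_integral_diff(1)[OF set_integrable_mult_right[OF iG, of "of_real s"] set_integrable_mult_right[OF iF, of w]]
      by (simp add: zero_ereal_def)
    have "((\<lambda>x. norm (?F x)) \<longlongrightarrow> 0) (at_right 0)" unfolding nF using s w by real_asymp
    then show "((?F \<circ> real_of_ereal) \<longlongrightarrow> 0) (at_right 0)"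
      by (simp add: zero_ereal_def ereal_tendsto_simps tendsto_norm_zero_iff del: norm_mult)
    have "((\<lambda>x. norm (?F x)) \<longlongrightarrow> 0) at_top" unfolding nF using s w by real_asymp
    then show "((?F \<circ> real_of_ereal) \<longlongrightarrow> 0) (at_left \<infinity>)"
      by (simp add: ereal_tendsto_simps tendsto_norm_zero_iff)
  qed auto
  then have "(LINT x:{0<..}|lborel. of_real s * ?G x - w * ?F x) = 0"
    by (simp add: interval_integral_to_infinity_eq zero_ereal_def)
  then show ?thesis
    by (subst (asm) set_integral_diff(2))
       (use iF iG in \<open>auto intro: set_integrable_mult_right\<close>)
qed

text \<open>Carrying a moment order k and a frequency t together lets one recurrence in k serve
  twice: k = 0 gives the differential equation of the characteristic function, t = 0 gives the
  moments.\<close>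

definition gamma_fourier :: "real \<Rightarrow> nat \<Rightarrow> real \<Rightarrow> complex" where
  "gamma_fourier r k t = (LINT x|lborel. iexp (t * x) * of_real (x ^ k * gamma_dens r x))"

lemma gamma_dens_nonneg: "r > 0 \<Longrightarrow> gamma_dens r x \<ge> 0"
  by (auto simp: gamma_dens_def intro!: Gamma_real_pos less_imp_le)

lemma gamma_dens_measurable[measurable]: "gamma_dens r \<in> borel_measurable borel"
  unfolding gamma_dens_def by measurable

lemma gamma_fourier_integrand:
  assumes "r > 0"
  shows "iexp (t * x) * of_real (x ^ k * gamma_dens r x) = of_real (r powr r / Gamma r) *
     (indicator {0<..} x *\<^sub>R (of_real (x powr (r + real k - 1)) * exp (- ((of_real r - \<i> * of_real t) * of_real x))))"
proof (cases "x > 0")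
  case True
  have "x powr (r + real k - 1) = x powr real k * x powr (r - 1)"
    by (simp add: algebra_simps flip: powr_add)
  also have "\<dots> = x ^ k * x powr (r - 1)" using True by (simp add: powr_realpow)
  finally have 1: "x powr (r + real k - 1) = x ^ k * x powr (r - 1)" .
  have "- ((of_real r - \<i> * of_real t) * of_real x) = \<i> * complex_of_real (t * x) + complex_of_real (- r * x)"
    by (simp add: algebra_simps)
  then have "exp (- ((of_real r - \<i> * of_real t) * of_real x)) = iexp (t * x) * complex_of_real (exp (- r * x))"
    by (simp only: exp_add exp_of_real)
  then show ?thesis unfolding 1 using True by (simp add: gamma_dens_def)
qed (auto simp: gamma_dens_def)

lemma gamma_fourier_integrable:
  assumes "r > 0"
  shows "integrable lborel (\<lambda>x. iexp (t * x) * of_real (x ^ k * gamma_dens r x))"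
  unfolding gamma_fourier_integrand[OF assms]
  using powr_exp_set_integrable[of "r + real k" "of_real r - \<i> * of_real t"] assms
  by (intro integrable_mult_right) (simp add: set_integrable_def)

lemma gamma_moment_integrable:
  assumes "r > 0"
  shows "integrable lborel (\<lambda>x. x ^ k * gamma_dens r x)"
  using gamma_fourier_integrable[OF assms, of 0 k] by (simp add: complex_of_real_integrable_eq del: of_real_mult of_real_power)

lemma gamma_fourier_Suc:
  assumes "r > 0"
  shows "(of_real r - \<i> * of_real t) * gamma_fourier r (Suc k) t = of_real (r + real k) * gamma_fourier r k t"
proof -
  let ?w = "of_real r - \<i> * of_real t"
  have eq: "gamma_fourier r k t = of_real (r powr r / Gamma r) *
      (LINT x:{0<..}|lborel. of_real (x powr (r + real k - 1)) * exp (- (?w * of_real x)))" for k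
    unfolding gamma_fourier_def gamma_fourier_integrand[OF assms] set_lebesgue_integral_def
    by (rule integral_mult_right_zero)
  have "?w * (LINT x:{0<..}|lborel. of_real (x powr (r + real k)) * exp (- (?w * of_real x)))
    = of_real (r + real k) * (LINT x:{0<..}|lborel. of_real (x powr (r + real k - 1)) * exp (- (?w * of_real x)))"
    using assms by (intro powr_exp_integral_Suc) auto
  then have "?w * (of_real c * (LINT x:{0<..}|lborel. of_real (x powr (r + real k)) * exp (- (?w * of_real x))))
    = of_real (r + real k) * (of_real c * (LINT x:{0<..}|lborel. of_real (x powr (r + real k - 1)) * exp (- (?w * of_real x))))" for c
    by (simp only: mult.left_commute[of _ "of_real c"])
  moreover have "r + real (Suc k) - 1 = r + real k" by simp
  ultimately show ?thesis unfolding eq by (simp only:)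
qed

text \<open>The recurrence at k = 0 is a linear first-order equation in t, so the product of the
  transform with the inverse of the claimed value has derivative zero. The value at t = 0 is assumed
  here; \<open>gamma_distributed\<close> gets it from the total mass of the probability space
  instead of evaluating a Gamma integral.\<close>

lemma gamma_fourier_closed_form:
  assumes r: "r > 0" and one: "gamma_fourier r 0 0 = 1"
  shows "gamma_fourier r 0 t = exp (- of_real r * Ln (1 - \<i> * of_real (t / r)))"
proof -
  let ?w = "\<lambda>t. exp (of_real r * Ln (1 - \<i> * of_real (t / r)))"
  have dh: "(gamma_fourier r 0 has_vector_derivative \<i> * gamma_fourier r 1 t) (at t)" for t
  proof -
    have "((\<lambda>t. LINT x|lborel. iexp (t * x) * of_real (gamma_dens r x)) has_vector_derivative
           (LINT x|lborel. \<i> * of_real x * iexp (t * x) * of_real (gamma_dens r x))) (at t)"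
      using gamma_fourier_integrable[OF r, of 0 0] gamma_fourier_integrable[OF r, of 0 1]
      by (intro has_vector_derivative_fourier) auto
    moreover have "(\<lambda>t. LINT x|lborel. iexp (t * x) * of_real (gamma_dens r x)) = gamma_fourier r 0"
      by (simp add: gamma_fourier_def fun_eq_iff)
    moreover have "(LINT x|lborel. \<i> * of_real x * iexp (t * x) * of_real (gamma_dens r x)) = \<i> * gamma_fourier r 1 t"
      unfolding gamma_fourier_def integral_mult_right_zero[symmetric]
      by (rule Bochner_Integration.integral_cong) (simp_all add: mult_ac)
    ultimately show ?thesis by simp
  qed
  have dw: "(?w has_vector_derivative - \<i> / (1 - \<i> * of_real (t / r)) * ?w t) (at t)" for t
  proof -
    \<comment> \<open>The argument of \<open>Ln\<close> has real part 1 and so stays off the branch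
      cut.\<close>
    have "1 - \<i> * (complex_of_real t / complex_of_real r) \<notin> \<real>\<^sub>\<le>\<^sub>0"
      by (auto simp: complex_nonpos_Reals_iff simp flip: of_real_divide)
    then have "((\<lambda>t. exp (of_real r * Ln (1 - \<i> * (t / of_real r)))) has_field_derivative
        - \<i> / (1 - \<i> * of_real (t / r)) * ?w t) (at (of_real t))"
      using r by (auto intro!: derivative_eq_intros) (simp add: divide_inverse)
    from has_vector_derivative_real_field[OF this] show ?thesis by simp
  qed
  have "((\<lambda>t. gamma_fourier r 0 t * ?w t) has_vector_derivative 0) (at t)" for t
  proof -
    have nz: "1 - \<i> * complex_of_real (t / r) \<noteq> 0" by (auto simp: complex_eq_iff)
    have "(of_real r - \<i> * of_real t) * gamma_fourier r 1 t = of_real r * gamma_fourier r 0 t"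
      using gamma_fourier_Suc[OF r, of t 0] by simp
    moreover have "of_real r - \<i> * of_real t = of_real r * (1 - \<i> * complex_of_real (t / r))"
      using r by (simp add: field_simps)
    ultimately have "(1 - \<i> * complex_of_real (t / r)) * gamma_fourier r 1 t = gamma_fourier r 0 t"
      using r by simp
    then have "gamma_fourier r 1 t = gamma_fourier r 0 t / (1 - \<i> * complex_of_real (t / r))"
      using nz by (auto simp: field_simps)
    with has_vector_derivative_mult[OF dh[of t] dw[of t]] show ?thesis by simp
  qed
  then obtain c where c: "\<And>t. gamma_fourier r 0 t * ?w t = c"
    using has_vector_derivative_zero_constant[of UNIV "\<lambda>t. gamma_fourier r 0 t * ?w t"] by auto
  have "gamma_fourier r 0 t * ?w t = 1" using c[of t] c[of 0] one by simp
  then show ?thesis by (simp add: exp_minus field_simps)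
qed

lemma (in prob_space) gamma_distributed:
  assumes r: "r > 0" and D: "distributed M lborel X (\<lambda>x. ennreal (gamma_dens r x))"
  shows gamma_distributed_integrable: "integrable M (\<lambda>\<omega>. X \<omega> ^ k)"
    and gamma_distributed_mean: "expectation X = 1"
    and gamma_distributed_variance: "expectation (\<lambda>\<omega>. (X \<omega> - 1)\<^sup>2) = 1 / r"
    and gamma_distributed_char: "char (distr M borel X) t = exp (- of_real r * Ln (1 - \<i> * of_real (t / r)))"
proof -
  note pos = gamma_dens_nonneg[OF r]
  have int: "integrable M (\<lambda>\<omega>. X \<omega> ^ k)" for k
    by (subst distributed_integrable[OF D, symmetric]) (use pos gamma_moment_integrable[OF r, of k] in \<open>auto simp: mult.commute\<close>)
  then show "integrable M (\<lambda>\<omega>. X \<omega> ^ k)" .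
  have mom: "of_real (expectation (\<lambda>\<omega>. X \<omega> ^ k)) = gamma_fourier r k 0" for k
  proof -
    have "expectation (\<lambda>\<omega>. X \<omega> ^ k) = (LBINT x. gamma_dens r x * x ^ k)"
      using pos by (intro distributed_integral[OF D, symmetric]) auto
    then show ?thesis
      by (simp add: gamma_fourier_def mult.commute flip: integral_complex_of_real of_real_mult of_real_power)
  qed
  from mom[of 0] have m0: "gamma_fourier r 0 0 = 1" by (simp add: prob_space)
  from gamma_fourier_Suc[OF r, of 0 0] m0 r have m1: "gamma_fourier r 1 0 = 1" by simp
  from gamma_fourier_Suc[OF r, of 0 1] m1 r have m2: "gamma_fourier r 2 0 = of_real ((r + 1) / r)"
    by (simp add: field_simps numeral_2_eq_2)
  have e1: "expectation X = 1" using mom[of 1] m1 by simp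
  then show "expectation X = 1" .
  have e2: "expectation (\<lambda>\<omega>. (X \<omega>)\<^sup>2) = (r + 1) / r" using mom[of 2] unfolding m2 of_real_eq_iff .
  have "expectation (\<lambda>\<omega>. (X \<omega> - 1)\<^sup>2) = expectation (\<lambda>\<omega>. (X \<omega>)\<^sup>2 - 2 * X \<omega> + 1)"
    by (simp add: power2_eq_square algebra_simps)
  also have "\<dots> = (r + 1) / r - 2 * 1 + 1"
    using int[of 1] int[of 2] e1 e2 by (simp add: prob_space)
  finally show "expectation (\<lambda>\<omega>. (X \<omega> - 1)\<^sup>2) = 1 / r" using r by (simp add: field_simps)
  have "distr M borel X = distr M lborel X" by (rule distr_cong) auto
  also have "\<dots> = density lborel (\<lambda>x. ennreal (gamma_dens r x))"
    by (rule distributed_distr_eq_density[OF D])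
  finally have "char (distr M borel X) t = gamma_fourier r 0 t"
    unfolding char_def gamma_fourier_def using pos
    by (simp add: integral_density scaleR_conv_of_real mult.commute)
  then show "char (distr M borel X) t = exp (- of_real r * Ln (1 - \<i> * of_real (t / r)))"
    using gamma_fourier_closed_form[OF r m0] by simp
qed

section \<open>Hermite polynomials and Fourier inversion\<close>

abbreviation gauss_deriv :: "nat \<Rightarrow> real \<Rightarrow> real" where
  "gauss_deriv k \<equiv> (deriv ^^ k) (\<lambda>t. exp (- t\<^sup>2 / 2))"

text \<open>\<open>hermite\<close> is built on the total operator \<open>deriv\<close>, which is
  informative only where derivatives exist. Writing each iterate as a polynomial times the Gaussian
  settles both differentiability and decay.\<close>

lemma gauss_deriv_poly:
  obtains p where "gauss_deriv k = (\<lambda>x. poly p x * exp (- x\<^sup>2 / 2))"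
    and "gauss_deriv (Suc k) = (\<lambda>x. poly (pderiv p - pCons 0 p) x * exp (- x\<^sup>2 / 2))"
proof -
  have step: "((\<lambda>x. poly p x * exp (- x\<^sup>2 / 2)) has_real_derivative poly (pderiv p - pCons 0 p) x * exp (- x\<^sup>2 / 2)) (at x)"
    for p and x :: real
    by (auto intro!: derivative_eq_intros simp: algebra_simps)
  have Suc_eq: "gauss_deriv (Suc k) = (\<lambda>x. poly (pderiv p - pCons 0 p) x * exp (- x\<^sup>2 / 2))"
    if "gauss_deriv k = (\<lambda>x. poly p x * exp (- x\<^sup>2 / 2))" for k p
  proof -
    have "gauss_deriv (Suc k) = deriv (gauss_deriv k)" by simp
    also have "\<dots> = (\<lambda>x. poly (pderiv p - pCons 0 p) x * exp (- x\<^sup>2 / 2))"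
      unfolding that by (rule ext, rule DERIV_imp_deriv, rule step)
    finally show ?thesis .
  qed
  have "\<exists>p. gauss_deriv k = (\<lambda>x. poly p x * exp (- x\<^sup>2 / 2))"
  proof (induction k)
    case 0 show ?case by (rule exI[of _ 1]) simp
  next
    case (Suc k)
    then show ?case using Suc_eq by blast
  qed
  with that Suc_eq show ?thesis by blast
qed

lemma gauss_deriv_DERIV: "(gauss_deriv k has_real_derivative gauss_deriv (Suc k) x) (at x)"
proof -
  obtain p where p: "gauss_deriv k = (\<lambda>x. poly p x * exp (- x\<^sup>2 / 2))"
    "gauss_deriv (Suc k) = (\<lambda>x. poly (pderiv p - pCons 0 p) x * exp (- x\<^sup>2 / 2))" by (rule gauss_deriv_poly)
  show ?thesis unfolding p by (auto intro!: derivative_eq_intros simp: algebra_simps)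
qed

lemma gauss_deriv_at_bot: "(gauss_deriv k \<longlongrightarrow> 0) at_bot"
proof -
  obtain p where p: "gauss_deriv k = (\<lambda>x. poly p x * exp (- x\<^sup>2 / 2))" by (rule gauss_deriv_poly)
  have "((\<lambda>x::real. x ^ i * exp (- x\<^sup>2 / 2)) \<longlongrightarrow> 0) at_bot" for i
  proof -
    have "((\<lambda>x::real. x ^ i * exp (- x\<^sup>2 / 2)) \<longlongrightarrow> 0) at_top"
    proof (rule Lim_null_comparison[OF _ tendsto_power_div_exp_0])
      have "norm (x ^ i * exp (- x\<^sup>2 / 2)) \<le> x ^ i / exp x" if "x \<ge> 2" for x :: real
      proof -
        have "2 * x \<le> x * x" using that by (intro mult_right_mono) auto
        then have "exp (- x\<^sup>2 / 2) \<le> exp (- x)" by (simp add: power2_eq_square)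
        then have "x ^ i * exp (- x\<^sup>2 / 2) \<le> x ^ i * exp (- x)" using that by (intro mult_left_mono) auto
        moreover have "x ^ i * exp (- x) = x ^ i / exp x" by (simp add: exp_minus divide_inverse)
        moreover have "norm (x ^ i * exp (- x\<^sup>2 / 2)) = x ^ i * exp (- x\<^sup>2 / 2)" using that by simp
        ultimately show ?thesis by linarith
      qed
      then show "\<forall>\<^sub>F x in at_top. norm (x ^ i * exp (- x\<^sup>2 / 2)) \<le> x ^ i / exp x"
        by (rule eventually_mono[OF eventually_ge_at_top[of 2]])
    qed
    moreover have "(- x) ^ i * exp (- (- x)\<^sup>2 / 2) = (-1) ^ i * (x ^ i * exp (- x\<^sup>2 / 2))" for x :: real
      by (subst power_minus) (simp add: mult.assoc)
    ultimately have "((\<lambda>x::real. (- x) ^ i * exp (- (- x)\<^sup>2 / 2)) \<longlongrightarrow> 0) at_top"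
      by (simp only: tendsto_mult_right_zero)
    then show ?thesis unfolding filterlim_at_bot_mirror .
  qed
  then have "((\<lambda>x::real. \<Sum>i\<le>degree p. coeff p i * (x ^ i * exp (- x\<^sup>2 / 2))) \<longlongrightarrow> 0) at_bot"
    by (intro tendsto_null_sum tendsto_mult_right_zero)
  then show ?thesis unfolding p by (simp add: poly_altdef sum_distrib_right mult.assoc)
qed

text \<open>The growing exponential in \<open>hermite\<close> cancels against \<open>phi\<close>, so
  all analysis of the expansion can be done on derivatives of the Gaussian.\<close>

lemma phi_hermite: "phi x * hermite k x = (-1) ^ k / sqrt (2 * pi) * gauss_deriv k x"
  by (simp add: phi_def std_normal_density_def hermite_def exp_minus field_simps)

lemma isCont_phi_hermite: "isCont (\<lambda>x. phi x * hermite k x) x"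
  unfolding phi_hermite using DERIV_isCont[OF gauss_deriv_DERIV] by (intro continuous_intros) auto

lemma phi_hermite_at_bot: "((\<lambda>x. phi x * hermite k x) \<longlongrightarrow> 0) at_bot"
  unfolding phi_hermite by (intro tendsto_mult_right_zero gauss_deriv_at_bot)

lemma gauss_moment_integrable: "integrable lborel (\<lambda>t. t ^ k * exp (- t\<^sup>2 / 2) :: real)"
proof -
  have "integrable lborel (\<lambda>t. sqrt (2 * pi) * (std_normal_density t * t ^ k))"
    by (intro integrable_mult_right integrable_std_normal_moment)
  then show ?thesis by (simp add: std_normal_density_def mult.commute)
qed

lemma gauss_fourier_integrable:
  "integrable lborel (\<lambda>t. iexp (- (t * x)) * ((\<i> * of_real t) ^ k * of_real (exp (- t\<^sup>2 / 2))))"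
  by (rule Bochner_Integration.integrable_bound[OF integrable_abs[OF gauss_moment_integrable[of k]]])
     (auto simp: norm_mult norm_power abs_mult power_abs simp flip: of_real_mult of_real_minus)

text \<open>The case k = 0 is the self-duality of the Gaussian. Differentiating in x brings down - i
  t in the integral and raises the order of the Gaussian derivative on the other side; uniqueness of
  derivatives carries the identity from k to k + 1.\<close>

lemma gauss_fourier:
  "(LINT t|lborel. iexp (- (t * x)) * ((\<i> * of_real t) ^ k * of_real (exp (- t\<^sup>2 / 2)))) =
     of_real (2 * pi * (phi x * hermite k x))"
proof -
  let ?G = "\<lambda>k x. LINT t|lborel. iexp (- (t * x)) * ((\<i> * of_real t) ^ k * of_real (exp (- t\<^sup>2 / 2)))"
  have dG: "(?G k has_vector_derivative - ?G (Suc k) x) (at x)" for k x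
  proof -
    have "((\<lambda>s. LINT t|lborel. iexp (s * t) * ((\<i> * of_real t) ^ k * of_real (exp (- t\<^sup>2 / 2)))) has_vector_derivative
      (LINT t|lborel. \<i> * of_real t * iexp ((-x) * t) * ((\<i> * of_real t) ^ k * of_real (exp (- t\<^sup>2 / 2))))) (at (-x))"
    proof (rule has_vector_derivative_fourier)
      show "integrable lborel (\<lambda>t. (\<i> * of_real t) ^ k * of_real (exp (- t\<^sup>2 / 2)))"
        using gauss_fourier_integrable[of 0 k] by simp
      have "integrable lborel (\<lambda>t. (-\<i>) * ((\<i> * of_real t) ^ Suc k * of_real (exp (- t\<^sup>2 / 2))))"
        using gauss_fourier_integrable[of 0 "Suc k"] by (intro integrable_mult_right) simp
      then show "integrable lborel (\<lambda>t. of_real t * ((\<i> * of_real t) ^ k * of_real (exp (- t\<^sup>2 / 2))))"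
        by (simp add: algebra_simps)
    qed
    from vector_diff_chain_at[OF has_vector_derivative_minus[OF has_vector_derivative_id] this]
    have "((\<lambda>x. LINT t|lborel. iexp ((-x) * t) * ((\<i> * of_real t) ^ k * of_real (exp (- t\<^sup>2 / 2)))) has_vector_derivative
      - (LINT t|lborel. \<i> * of_real t * iexp ((-x) * t) * ((\<i> * of_real t) ^ k * of_real (exp (- t\<^sup>2 / 2))))) (at x)"
      by (simp add: comp_def)
    then show ?thesis by (simp add: mult_ac)
  qed
  have "?G k x = of_real (sqrt (2 * pi) * (-1) ^ k * gauss_deriv k x)"
  proof (induction k arbitrary: x)
    case 0
    have "of_real (exp (- x\<^sup>2 / 2)) = char std_normal_distribution (- x)"
      by (simp add: char_std_normal_distribution)
    also have "\<dots> = (LINT t|lborel. of_real (1 / sqrt (2 * pi)) * (iexp (- (t * x)) * of_real (exp (- t\<^sup>2 / 2))))"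
      unfolding char_def
      by (subst integral_density) (auto simp: std_normal_density_def scaleR_conv_of_real mult_ac intro!: Bochner_Integration.integral_cong)
    also have "\<dots> = of_real (1 / sqrt (2 * pi)) * ?G 0 x" by (subst integral_mult_right_zero) simp
    finally have "of_real (sqrt (2 * pi)) * of_real (exp (- x\<^sup>2 / 2)) = ?G 0 x" by simp
    then show ?case by simp
  next
    case (Suc k)
    have "((\<lambda>x. complex_of_real (sqrt (2 * pi) * (-1) ^ k * gauss_deriv k x)) has_vector_derivative
        of_real (sqrt (2 * pi) * (-1) ^ k * gauss_deriv (Suc k) x)) (at x)"
      by (intro has_vector_derivative_of_real DERIV_cmult gauss_deriv_DERIV)
    with dG[of k x] have "- ?G (Suc k) x = of_real (sqrt (2 * pi) * (-1) ^ k * gauss_deriv (Suc k) x)"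
      unfolding Suc.IH by (rule vector_derivative_unique_at)
    then have "?G (Suc k) x = - of_real (sqrt (2 * pi) * (-1) ^ k * gauss_deriv (Suc k) x)"
      by (rule minus_equation_iff[THEN iffD1, symmetric])
    then show ?case by simp
  qed
  also have "sqrt (2 * pi) * (-1) ^ k * gauss_deriv k x = 2 * pi * (phi x * hermite k x)"
    unfolding phi_hermite by (simp add: field_simps real_sqrt_mult_self)
  finally show ?thesis .
qed

section \<open>Levy inversion and the comparison of distribution functions\<close>

abbreviation levy_kernel :: "real \<Rightarrow> real \<Rightarrow> real \<Rightarrow> complex" where
  "levy_kernel a b t \<equiv> (iexp (- (t * a)) - iexp (- (t * b))) / (\<i> * of_real t)"

lemma levy_kernel_set_integrable:
  fixes f :: "real \<Rightarrow> complex"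
  assumes "a \<le> b" and [measurable]: "f \<in> borel_measurable borel" and f: "\<And>t. norm (f t) \<le> B"
  shows "set_integrable lborel {-T..T} (\<lambda>t. levy_kernel a b t * f t)"
  unfolding set_integrable_def
proof (rule integrableI_bounded_set_indicator[where B="(b - a) * B"])
  have "norm (levy_kernel a b t * f t) \<le> (b - a) * B" for t
  proof (cases "t = 0")
    \<comment> \<open>By the convention x / 0 = 0 the kernel vanishes here.\<close>
    case True
    have "0 \<le> B" using f[of 0] norm_ge_zero order_trans by blast
    with True assms(1) show ?thesis by simp
  next
    case False
    have "norm (levy_kernel a b t) \<le> b - a"
      using Levy_Inversion_aux2[of "-b" "-a" t] assms(1) False by simp
    then show ?thesis unfolding norm_mult using f[of t] assms(1) by (intro mult_mono) auto
  qed
  then show "AE t in lborel. t \<in> {-T..T} \<longrightarrow> norm (levy_kernel a b t * f t) \<le> (b - a) * B" by simp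
qed (auto simp: emeasure_lborel_Icc_eq)

lemma (in real_distribution) Levy_Inversion_Icc:
  assumes "a \<le> b" "measure M {a} = 0" "measure M {b} = 0"
  shows "(\<lambda>T. LINT t:{- real T..real T}|lborel. levy_kernel a b t * char M t)
      \<longlonglongrightarrow> of_real (2 * pi * measure M {a<..b})"
proof -
  note lim = tendsto_mult_left[OF Levy_Inversion[OF assms], of "of_real (2 * pi)"]
  have "(CLBINT t=-real T..real T. levy_kernel a b t * char M t)
     = (LINT t:{- real T..real T}|lborel. levy_kernel a b t * char M t)" for T
    using interval_integral_Icc[of "- real T" "real T"] by simp
  with lim show ?thesis by simp
qed

text \<open>The denominator of the kernel cancels one power of i t. Hence a term with exponent
  \<open>Suc j\<close> on the transform side corresponds to \<open>hermite j\<close> in the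
  expansion.\<close>

lemma levy_kernel_gauss:
  assumes "t \<noteq> 0"
  shows "levy_kernel a b t * ((\<i> * of_real t) ^ Suc j * of_real (exp (- t\<^sup>2 / 2)))
    = iexp (- (t * a)) * ((\<i> * of_real t) ^ j * of_real (exp (- t\<^sup>2 / 2)))
      - iexp (- (t * b)) * ((\<i> * of_real t) ^ j * of_real (exp (- t\<^sup>2 / 2)))"
proof -
  have "(u - v) / w * (w ^ Suc j * e) = u * (w ^ j * e) - v * (w ^ j * e)" if "w \<noteq> 0" for u v w e :: complex
    using that by (simp add: field_simps)
  from this[of "\<i> * of_real t"] assms show ?thesis by simp
qed

lemma levy_kernel_gauss_integral:
  fixes a b :: real and j :: nat
  defines "f \<equiv> \<lambda>t::real. levy_kernel a b t * ((\<i> * of_real t) ^ Suc j * of_real (exp (- t\<^sup>2 / 2)))"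
  shows levy_kernel_gauss_integrable: "integrable lborel f"
    and "(LINT t|lborel. f t) = of_real (2 * pi * (phi a * hermite j a - phi b * hermite j b))"
proof -
  let ?f = "\<lambda>x t. iexp (- (t * x)) * ((\<i> * of_real t) ^ j * of_real (exp (- t\<^sup>2 / 2)))"
  have eq: "f t = ?f a t - ?f b t" if "t \<notin> {0}" for t
    using that levy_kernel_gauss[of t a b j] by (simp only: f_def singleton_iff not_False_eq_True)
  have "integrable lborel (\<lambda>t. ?f a t - ?f b t)"
    by (intro Bochner_Integration.integrable_diff gauss_fourier_integrable)
  then show "integrable lborel f"
    by (subst integrable_discrete_difference[where X="{0}", OF _ _ _ eq]) auto
  have "(LINT t|lborel. f t) = (LINT t|lborel. ?f a t - ?f b t)"
    by (rule integral_discrete_difference[where X="{0}", OF _ _ _ eq]) auto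
  also have "\<dots> = of_real (2 * pi * (phi a * hermite j a - phi b * hermite j b))"
    by (subst Bochner_Integration.integral_diff[OF gauss_fourier_integrable gauss_fourier_integrable])
       (simp only: gauss_fourier right_diff_distrib of_real_diff)
  finally show "(LINT t|lborel. f t) = of_real (2 * pi * (phi a * hermite j a - phi b * hermite j b))" .
qed

lemma integral_Icc_tendsto:
  fixes f :: "real \<Rightarrow> complex"
  assumes int: "integrable lborel f"
  shows "(\<lambda>T. LINT t:{- real T..real T}|lborel. f t) \<longlonglongrightarrow> (LINT t|lborel. f t)"
  unfolding set_lebesgue_integral_def
proof (rule integral_dominated_convergence[where w="\<lambda>t. norm (f t)"])
  show "AE t in lborel. (\<lambda>T. indicator {- real T..real T} t *\<^sub>R f t) \<longlonglongrightarrow> f t"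
  proof (intro AE_I2 tendsto_eventually)
    fix t :: real
    obtain n where "\<bar>t\<bar> \<le> real n" using real_arch_simple by blast
    then show "\<forall>\<^sub>F T in sequentially. indicator {- real T..real T} t *\<^sub>R f t = f t"
      by (intro eventually_sequentiallyI[of n]) (auto simp: indicator_def)
  qed
qed (use int in \<open>auto simp: indicator_def\<close>)

lemma isCont_Phi: "isCont Phi x"
proof -
  interpret N: real_distribution std_normal_distribution by (rule real_dist_normal_dist)
  have "emeasure std_normal_distribution {x} = 0"
    by (subst emeasure_density) (auto simp: nn_integral_indicator_singleton)
  then show ?thesis unfolding Phi_def N.isCont_cdf by (simp add: measure_def)
qed

text \<open>The expansion need not be a distribution function, so Levy inversion is applied to
  \<open>M\<close> and to the normal law separately, while the Hermite terms are inverted exactly.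
  The kernel is at most 2 / |t|, which cancels the |t| in \<open>bound\<close> and leaves the
  majorant 2 g, free of a, b and T; dividing by 2 pi gives the factor 1 / pi.\<close>

lemma (in real_distribution) smoothing_inequality:
  fixes c :: "'k \<Rightarrow> real" and j :: "'k \<Rightarrow> nat" and g :: "real \<Rightarrow> real"
  assumes g: "integrable lborel g" and g0: "\<And>t. g t \<ge> 0"
    and bound: "\<And>t. t \<noteq> 0 \<Longrightarrow> norm (char M t - of_real (exp (- t\<^sup>2 / 2)) *
        (1 + (\<Sum>k\<in>K. of_real (c k) * (\<i> * of_real t) ^ Suc (j k)))) \<le> \<bar>t\<bar> * g t"
  shows "\<bar>cdf M x - (Phi x - phi x * (\<Sum>k\<in>K. c k * hermite (j k) x))\<bar> \<le> (LINT t|lborel. g t) / pi"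
proof -
  interpret N: real_distribution std_normal_distribution by (rule real_dist_normal_dist)
  define P where "P y = phi y * (\<Sum>k\<in>K. c k * hermite (j k) y)" for y
  define B where "B = (LINT t|lborel. g t) / pi"
  have P_eq: "P = (\<lambda>y. \<Sum>k\<in>K. c k * (phi y * hermite (j k) y))"
    by (simp add: P_def fun_eq_iff sum_distrib_left mult_ac)
  have P_cont: "isCont P y" for y
    unfolding P_eq by (intro continuous_intros isCont_phi_hermite)
  have P_bot: "(P \<longlongrightarrow> 0) at_bot"
    unfolding P_eq by (intro tendsto_null_sum tendsto_mult_right_zero phi_hermite_at_bot)
  have atom_N: "measure std_normal_distribution {y} = 0" for y
    using isCont_Phi[of y] N.isCont_cdf[of y] by (simp add: Phi_def[abs_def])
  have incr: "\<bar>(cdf M b - cdf M a) - ((Phi b - P b) - (Phi a - P a))\<bar> \<le> B"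
    if ab: "a < b" and atoms: "measure M {a} = 0" "measure M {b} = 0" for a b
  proof -
    let ?k = "levy_kernel a b"
    let ?I = "\<lambda>f T. LINT t:{- real T..real T}|lborel. f t"
    let ?G = "\<lambda>k t. ?k t * ((\<i> * of_real t) ^ Suc (j k) * of_real (exp (- t\<^sup>2 / 2)))"
    let ?M = "\<lambda>t. ?k t * char M t" and ?N = "\<lambda>t. ?k t * char std_normal_distribution t"
    let ?D = "\<lambda>t. ?M t - (?N t + (\<Sum>k\<in>K. of_real (c k) * ?G k t))"
    have sM: "set_integrable lborel {-T..T} ?M" for T
      using ab cmod_char_le_1 by (intro levy_kernel_set_integrable[where B=1]) auto
    have sN: "set_integrable lborel {-T..T} ?N" for T
      using ab N.cmod_char_le_1 by (intro levy_kernel_set_integrable[where B=1]) auto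
    have iG: "integrable lborel (\<lambda>t. \<Sum>k\<in>K. of_real (c k) * ?G k t)"
      by (intro Bochner_Integration.integrable_sum integrable_mult_right levy_kernel_gauss_integrable)
    have sG: "set_integrable lborel {-T..T} (\<lambda>t. \<Sum>k\<in>K. of_real (c k) * ?G k t)" for T
      unfolding set_integrable_def by (rule integrable_mult_indicator[OF _ iG]) simp
    have ID: "?I ?D T = ?I ?M T - (?I ?N T + ?I (\<lambda>t. \<Sum>k\<in>K. of_real (c k) * ?G k t) T)" for T
      using sM sN sG by (simp only: set_integral_diff set_integral_add)
    have lim: "(\<lambda>T. norm (?I ?D T)) \<longlonglongrightarrow> norm (complex_of_real (2 * pi * measure M {a<..b}) -
       (of_real (2 * pi * measure std_normal_distribution {a<..b}) + (LINT t|lborel. (\<Sum>k\<in>K. of_real (c k) * ?G k t))))"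
      unfolding ID using ab atoms atom_N
      by (intro tendsto_norm tendsto_diff tendsto_add Levy_Inversion_Icc N.Levy_Inversion_Icc integral_Icc_tendsto iG) auto
    have "(LINT t|lborel. (\<Sum>k\<in>K. of_real (c k) * ?G k t)) = (\<Sum>k\<in>K. of_real (c k) * (LINT t|lborel. ?G k t))"
      by (subst Bochner_Integration.integral_sum)
         (auto simp only: integral_mult_right_zero intro!: integrable_mult_right levy_kernel_gauss_integrable)
    also have "\<dots> = of_real (2 * pi * (P a - P b))"
      unfolding levy_kernel_gauss_integral(2) P_eq
      by (simp add: sum_distrib_left right_diff_distrib sum_subtractf mult_ac)
    finally have G_eq: "(LINT t|lborel. (\<Sum>k\<in>K. of_real (c k) * ?G k t)) = of_real (2 * pi * (P a - P b))" .
    have D_le: "norm (?D t) \<le> 2 * g t" if "t \<noteq> 0" for t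
    proof -
      have "?D t = ?k t * (char M t - of_real (exp (- t\<^sup>2 / 2)) * (1 + (\<Sum>k\<in>K. of_real (c k) * (\<i> * of_real t) ^ Suc (j k))))"
        by (simp add: char_std_normal_distribution algebra_simps sum_distrib_left)
      moreover have "norm (?k t) \<le> 2 / \<bar>t\<bar>"
      proof -
        have "norm (iexp (- (t * a)) - iexp (- (t * b))) \<le> 1 + 1"
          by (rule order_trans[OF norm_triangle_ineq4]) (simp add: norm_exp_i_times del: of_real_mult of_real_minus)
        then show ?thesis using that by (simp add: norm_divide norm_mult divide_right_mono)
      qed
      ultimately have "norm (?D t) \<le> 2 / \<bar>t\<bar> * (\<bar>t\<bar> * g t)"
        unfolding norm_mult using bound[OF that] by (simp only: norm_mult) (intro mult_mono, auto)
      then show ?thesis using that by simp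
    qed
    have "norm (?I ?D T) \<le> 2 * (LINT t|lborel. g t)" for T
    proof -
      have "norm (?I ?D T) \<le> (LINT t|lborel. 2 * g t)"
        unfolding set_lebesgue_integral_def
      proof (rule Bochner_Integration.integral_norm_bound_integral)
        show "integrable lborel (\<lambda>t. indicator {- real T..real T} t *\<^sub>R ?D t)"
          using set_integral_diff(1)[OF sM set_integral_add(1)[OF sN sG]] unfolding set_integrable_def .
        show "integrable lborel (\<lambda>t. 2 * g t)" using g by simp
        show "norm (indicator {- real T..real T} t *\<^sub>R ?D t) \<le> 2 * g t" for t
        proof (cases "t \<noteq> 0 \<and> t \<in> {- real T..real T}")
          case True
          then have t: "t \<noteq> 0" "t \<in> {- real T..real T}" by auto
          show ?thesis using D_le[OF t(1)] t(2) by (simp only: indicator_simps scaleR_one)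
        qed (use g0[of t] in auto)
      qed
      then show ?thesis by simp
    qed
    then have "norm (complex_of_real (2 * pi * measure M {a<..b}) -
       (of_real (2 * pi * measure std_normal_distribution {a<..b}) + of_real (2 * pi * (P a - P b)))) \<le> 2 * (LINT t|lborel. g t)"
      using lim unfolding G_eq by (intro LIMSEQ_le_const2) auto
    then have "\<bar>2 * pi * ((cdf M b - cdf M a) - ((Phi b - P b) - (Phi a - P a)))\<bar> \<le> 2 * (LINT t|lborel. g t)"
      unfolding cdf_diff_eq[OF ab] Phi_def N.cdf_diff_eq[OF ab, symmetric] of_real_add[symmetric] of_real_diff[symmetric] norm_of_real
      by (simp add: cdf_diff_eq[OF ab, symmetric] algebra_simps)
    moreover have "X \<le> I / pi" if "\<bar>2 * pi * Y\<bar> \<le> 2 * I" "X = \<bar>Y\<bar>" for X Y I :: real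
      using that by (simp add: abs_mult pos_le_divide_eq mult.commute)
    ultimately show ?thesis unfolding B_def by blast
  qed
  have "\<bar>cdf M x - (Phi x - P x)\<bar> \<le> B"
  proof (rule field_le_epsilon)
    fix e :: real assume "e > 0"
    \<comment> \<open>Six errors must fit into e: \<open>cdf M\<close>, \<open>Phi\<close> and
      \<open>P\<close> near minus infinity, and their changes from x to b. Inversion needs end
      points outside the countable set of atoms; x may be an atom and is therefore approached from
      the right.\<close>
    define e' where "e' = e / 6"
    have e': "e' > 0" using \<open>e > 0\<close> by (simp add: e'_def)
    let ?A = "{y. measure M {y} \<noteq> 0}"
    have "\<forall>\<^sub>F y in at_bot. \<bar>cdf M y\<bar> < e' \<and> \<bar>Phi y\<bar> < e' \<and> \<bar>P y\<bar> < e' \<and> y < x"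
      using tendstoD[OF cdf_lim_at_bot e'] tendstoD[OF N.cdf_lim_at_bot e'] tendstoD[OF P_bot e'] eventually_gt_at_bot[of x]
      by (eventually_elim) (simp add: dist_real_def Phi_def)
    then obtain a0 where a0: "\<And>y. y \<le> a0 \<Longrightarrow> \<bar>cdf M y\<bar> < e' \<and> \<bar>Phi y\<bar> < e' \<and> \<bar>P y\<bar> < e' \<and> y < x"
      by (auto simp: eventually_at_bot_linorder)
    obtain a where a: "a \<in> {..<a0}" "a \<notin> ?A"
      using open_minus_countable[OF countable_support, of "{..<a0}"] by (auto)
    have "\<forall>\<^sub>F y in at_right x. \<bar>cdf M y - cdf M x\<bar> < e' \<and> \<bar>Phi y - Phi x\<bar> < e' \<and> \<bar>P y - P x\<bar> < e'"
      using tendstoD[OF cdf_is_right_cont[of x, unfolded continuous_within] e']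
        tendstoD[OF continuous_at_imp_continuous_at_within[OF isCont_Phi[of x], of "{x<..}", unfolded continuous_within] e']
        tendstoD[OF continuous_at_imp_continuous_at_within[OF P_cont[of x], of "{x<..}", unfolded continuous_within] e']
      by (eventually_elim) (simp add: dist_real_def)
    then obtain b0 where b0: "b0 > x" "\<And>y. x < y \<Longrightarrow> y < b0 \<Longrightarrow> \<bar>cdf M y - cdf M x\<bar> < e' \<and> \<bar>Phi y - Phi x\<bar> < e' \<and> \<bar>P y - P x\<bar> < e'"
      by (auto simp: eventually_at_right_field)
    obtain b where b: "b \<in> {x<..<b0}" "b \<notin> ?A"
      using open_minus_countable[OF countable_support, of "{x<..<b0}"] b0(1) by auto
    have "a < b" using a0[of a] a b by auto
    have "\<bar>(cdf M b - cdf M a) - ((Phi b - P b) - (Phi a - P a))\<bar> \<le> B"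
      using incr[OF \<open>a < b\<close>] a b by auto
    then show "\<bar>cdf M x - (Phi x - P x)\<bar> \<le> B + e"
      using a0[of a] b0(2)[of b] a b unfolding e'_def abs_less_iff abs_le_iff by simp
  qed
  then show ?thesis unfolding P_def B_def .
qed

section \<open>Truncating the expansion of an exponential\<close>

lemma exp_series_PiE:
  fixes y :: "'i \<Rightarrow> 'c :: {banach, real_normed_field}"
  assumes "finite A"
  shows "((\<lambda>k. \<Prod>m\<in>A. y m ^ k m / fact (k m)) has_sum exp (\<Sum>m\<in>A. y m)) (PiE A (\<lambda>_. UNIV))"
    and "((\<lambda>k. norm (\<Prod>m\<in>A. y m ^ k m / fact (k m))) has_sum exp (\<Sum>m\<in>A. norm (y m))) (PiE A (\<lambda>_. UNIV))"
proof -
  have hs: "((\<lambda>n. x ^ n / fact n) has_sum exp x) UNIV" for x :: "'d :: {banach, real_normed_field}"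
  proof (rule norm_summable_imp_has_sum)
    show "summable (\<lambda>n. norm (x ^ n / fact n))"
      using summable_norm_exp[of x] by (simp add: scaleR_conv_of_real field_simps of_real_inverse)
    show "(\<lambda>n. x ^ n / fact n) sums exp x"
      using exp_converges[of x] by (simp add: scaleR_conv_of_real field_simps)
  qed
  have abs: "(\<lambda>n. x ^ n / fact n) abs_summable_on UNIV" for x :: "'d :: {banach, real_normed_field}"
    using hs[of "norm x"] by (auto simp: norm_divide norm_power has_sum_imp_summable)
  have infsum_eq: "infsum (\<lambda>k. \<Prod>m\<in>A. x m ^ k m / fact (k m)) (PiE A (\<lambda>_. UNIV)) = exp (\<Sum>m\<in>A. x m)"
    for x :: "'i \<Rightarrow> 'd :: {banach, real_normed_field}"
    by (subst infsum_prod_PiE_abs[OF assms abs]) (simp add: infsumI[OF hs] exp_sum[OF assms])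
  \<comment> \<open>An \<open>infsum\<close> over a family that is not summable is 0, whereas the
    value found for the norms is an exponential and hence positive. Summability is thus read off
    from the value.\<close>
  have "(\<lambda>k. \<Prod>m\<in>A. norm (y m) ^ k m / fact (k m)) summable_on (PiE A (\<lambda>_. UNIV))"
  proof (rule ccontr)
    assume "\<not> ?thesis"
    from infsum_not_exists[OF this] infsum_eq[of "\<lambda>m. norm (y m)"] show False by simp
  qed
  moreover have eq: "norm (\<Prod>m\<in>A. y m ^ k m / fact (k m)) = (\<Prod>m\<in>A. norm (y m) ^ k m / fact (k m))" for k
    by (simp add: norm_divide norm_power flip: prod_norm)
  ultimately have s: "(\<lambda>k. \<Prod>m\<in>A. y m ^ k m / fact (k m)) abs_summable_on (PiE A (\<lambda>_. UNIV))" by simp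
  from has_sum_infsum[OF this] show "((\<lambda>k. norm (\<Prod>m\<in>A. y m ^ k m / fact (k m))) has_sum exp (\<Sum>m\<in>A. norm (y m))) (PiE A (\<lambda>_. UNIV))"
    unfolding eq infsum_eq .
  from has_sum_infsum[OF abs_summable_summable[OF s]]
  show "((\<lambda>k. \<Prod>m\<in>A. y m ^ k m / fact (k m)) has_sum exp (\<Sum>m\<in>A. y m)) (PiE A (\<lambda>_. UNIV))"
    unfolding infsum_eq .
qed

text \<open>Sorting the multinomial expansion of the exponential by the weight \<open>\<Sum>m\<in>A. d m * k m\<close>, a factor
  \<open>q ^ n\<close> can be split off the terms of weight at least \<open>n\<close> (if \<open>q \<le> 1\<close>) or at most \<open>n\<close> (if \<open>q \<ge> 1\<close>).\<close>
lemma exp_truncation_bounds: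
  fixes y :: "'i \<Rightarrow> complex" and z :: "'i \<Rightarrow> real" and d :: "'i \<Rightarrow> nat" and n :: nat
  assumes A: "finite A" and d: "\<And>m. m \<in> A \<Longrightarrow> d m \<ge> 1"
    and q: "q \<ge> 0" and y: "\<And>m. m \<in> A \<Longrightarrow> norm (y m) \<le> q ^ d m * z m"
    and z: "\<And>m. m \<in> A \<Longrightarrow> z m \<ge> 0"
  defines "E \<equiv> {k \<in> PiE A (\<lambda>_. UNIV). (\<Sum>m\<in>A. d m * k m) < n}"
  defines "T \<equiv> \<lambda>k. \<Prod>m\<in>A. y m ^ k m / fact (k m)"
  shows finite_exp_truncation: "finite E"
    and exp_truncation_le: "q \<le> 1 \<Longrightarrow> norm (exp (\<Sum>m\<in>A. y m) - (\<Sum>k\<in>E. T k)) \<le> q ^ n * exp (\<Sum>m\<in>A. z m)"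
    and exp_truncation_ge: "q \<ge> 1 \<Longrightarrow> norm (\<Sum>k\<in>E. T k) \<le> q ^ n * exp (\<Sum>m\<in>A. z m)"
proof -
  let ?P = "PiE A (\<lambda>_. UNIV :: nat set)"
  let ?w = "\<lambda>k. \<Sum>m\<in>A. d m * k m"
  define Z where "Z = (\<lambda>k. \<Prod>m\<in>A. z m ^ k m / fact (k m))"
  \<comment> \<open>As every \<open>d m\<close> is at least 1, a bound on the weight bounds each
    entry of the tuple.\<close>
  have le_n: "k m \<le> n" if "k \<in> E" "m \<in> A" for k m
  proof -
    have "k m \<le> d m * k m" using d[OF that(2)] by simp
    also have "\<dots> \<le> ?w k" using A that by (intro member_le_sum) auto
    also have "\<dots> < n" using that by (simp add: E_def)
    finally show ?thesis by simp
  qed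
  have "E \<subseteq> PiE A (\<lambda>_. {..n})"
  proof
    fix k assume k: "k \<in> E"
    then have "k \<in> extensional A" by (simp add: E_def PiE_iff)
    with le_n[OF k] show "k \<in> PiE A (\<lambda>_. {..n})" by (simp add: PiE_iff)
  qed
  then show fin: "finite E" by (rule finite_subset) (use A in \<open>auto intro: finite_PiE\<close>)
  have Z0: "Z k \<ge> 0" for k unfolding Z_def by (intro prod_nonneg) (use z in auto)
  have ZP: "(Z has_sum exp (\<Sum>m\<in>A. z m)) ?P" unfolding Z_def by (rule exp_series_PiE(1)[OF A])
  have TP: "(T has_sum exp (\<Sum>m\<in>A. y m)) ?P" unfolding T_def by (rule exp_series_PiE(1)[OF A])
  have Tabs: "(\<lambda>k. norm (T k)) summable_on ?P"
    unfolding T_def using exp_series_PiE(2)[OF A] by (rule has_sum_imp_summable)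
  \<comment> \<open>\<open>Z\<close> is the series term for the exponential of the sum of the
    \<open>z m\<close>. Once the power of q is replaced by q ^ n, the sum of all remaining factors
    costs just that exponential.\<close>
  have Tle: "norm (T k) \<le> q ^ ?w k * Z k" for k
  proof -
    have "norm (T k) = (\<Prod>m\<in>A. norm (y m) ^ k m / fact (k m))"
      by (simp add: T_def norm_divide norm_power flip: prod_norm)
    also have "\<dots> \<le> (\<Prod>m\<in>A. (q ^ d m * z m) ^ k m / fact (k m))"
      using y by (intro prod_mono conjI divide_right_mono power_mono) auto
    also have "\<dots> = q ^ ?w k * Z k"
      by (simp add: Z_def power_mult_distrib power_sum prod.distrib prod_dividef flip: power_mult)
    finally show ?thesis .
  qed
  show "norm (exp (\<Sum>m\<in>A. y m) - (\<Sum>k\<in>E. T k)) \<le> q ^ n * exp (\<Sum>m\<in>A. z m)" if "q \<le> 1"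
  proof -
    have EP: "E \<subseteq> ?P" by (auto simp: E_def)
    have "(T has_sum (exp (\<Sum>m\<in>A. y m) - (\<Sum>k\<in>E. T k))) (?P - E)"
      by (rule has_sum_Diff[OF TP has_sum_finite[OF fin] EP])
    then have "norm (exp (\<Sum>m\<in>A. y m) - (\<Sum>k\<in>E. T k)) = norm (infsum T (?P - E))"
      by (simp add: infsumI)
    also have "\<dots> \<le> infsum (\<lambda>k. norm (T k)) (?P - E)"
      by (rule norm_infsum_bound) (rule summable_on_subset_banach[OF Tabs], auto)
    also have "\<dots> \<le> infsum (\<lambda>k. q ^ n * Z k) ?P"
    proof (rule infsum_mono_neutral)
      show "(\<lambda>k. norm (T k)) summable_on ?P - E" by (rule summable_on_subset_banach[OF Tabs]) auto
      show "(\<lambda>k. q ^ n * Z k) summable_on ?P"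
        using ZP by (intro summable_on_cmult_right) (rule has_sum_imp_summable)
      fix k assume "k \<in> (?P - E) \<inter> ?P"
      then have "q ^ ?w k \<le> q ^ n" using q that by (intro power_decreasing) (auto simp: E_def)
      then show "norm (T k) \<le> q ^ n * Z k"
        using Tle[of k] Z0[of k] by (meson mult_right_mono order_trans)
    qed (use Z0 q in auto)
    also have "\<dots> = q ^ n * exp (\<Sum>m\<in>A. z m)"
      using ZP by (subst infsum_cmult_right') (simp add: infsumI)
    finally show ?thesis .
  qed
  show "norm (\<Sum>k\<in>E. T k) \<le> q ^ n * exp (\<Sum>m\<in>A. z m)" if "q \<ge> 1"
  proof -
    have "norm (\<Sum>k\<in>E. T k) \<le> (\<Sum>k\<in>E. q ^ n * Z k)"
    proof (rule sum_norm_le)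
      fix k assume "k \<in> E"
      then have "q ^ ?w k \<le> q ^ n" using that by (intro power_increasing) (auto simp: E_def)
      then show "norm (T k) \<le> q ^ n * Z k"
        using Tle[of k] Z0[of k] by (meson mult_right_mono order_trans)
    qed
    also have "\<dots> = q ^ n * (\<Sum>k\<in>E. Z k)" by (rule sum_distrib_left[symmetric])
    also have "(\<Sum>k\<in>E. Z k) \<le> infsum Z ?P"
      using fin Z0 by (intro finite_sum_le_infsum has_sum_imp_summable[OF ZP]) (auto simp: E_def)
    also have "\<dots> = exp (\<Sum>m\<in>A. z m)" using ZP by (rule infsumI)
    finally show ?thesis using q by (simp add: mult_left_mono)
  qed
qed

section \<open>Tuples of the index set and their weights\<close>

lemma finite_eta_set: "finite (eta_set N)"
proof (rule finite_subset)
  show "finite ((\<lambda>k m. if m \<in> {3..N} then k m else 0) ` PiE {3..N} (\<lambda>_. {..N}))"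
    by (intro finite_imageI finite_PiE) auto
  show "eta_set N \<subseteq> (\<lambda>k m. if m \<in> {3..N} then k m else 0) ` PiE {3..N} (\<lambda>_. {..N})"
  proof
    fix k assume k: "k \<in> eta_set N"
    have "k m \<le> N" if "m \<in> {3..N}" for m
    proof -
      have "1 * k m \<le> (m - 2) * k m" using that by (intro mult_right_mono) auto
      then have "k m \<le> (m - 2) * k m" by simp
      also have "\<dots> \<le> (\<Sum>m=3..N. (m - 2) * k m)" using that by (intro member_le_sum) auto
      also have "\<dots> \<le> N - 2" using k by (simp add: eta_set_def)
      also have "\<dots> \<le> N" by simp
      finally show ?thesis .
    qed
    then show "k \<in> (\<lambda>k m. if m \<in> {3..N} then k m else 0) ` PiE {3..N} (\<lambda>_. {..N})"
      using k by (intro image_eqI[of _ _ "restrict k {3..N}"]) (auto simp: eta_set_def fun_eq_iff)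
  qed
qed

text \<open>The subtraction in \<open>zeta\<close> is on naturals; a tuple of positive weight has
  positive sum, so nothing is cut off.\<close>

lemma zeta_Suc: "k \<in> eta_set N \<Longrightarrow> Suc (zeta N k) = (\<Sum>m=3..N. m * k m)"
proof -
  assume "k \<in> eta_set N"
  then have "1 \<le> (\<Sum>m=3..N. (m - 2) * k m)" by (simp add: eta_set_def)
  also have "\<dots> \<le> (\<Sum>m=3..N. m * k m)" by (intro sum_mono) auto
  finally show ?thesis by (simp add: zeta_def)
qed

text \<open>Two encodings of tuples meet here: \<open>eta_set\<close> uses functions that are 0
  outside {3..N}, the series over \<open>PiE\<close> uses functions that are
  \<open>undefined\<close> there. The zero tuple has weight 0, lies outside \<open>eta_set N\<close>
  and accounts for the leading 1.\<close>

lemma sum_eta_set_PiE: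
  fixes f :: "(nat \<Rightarrow> nat) \<Rightarrow> 'c :: comm_ring_1"
  assumes N: "N \<ge> 2" and f: "\<And>k. f (restrict k {3..N}) = f k" and f0: "f (\<lambda>_. 0) = 1"
  shows "(\<Sum>k\<in>{k \<in> PiE {3..N} (\<lambda>_. UNIV). (\<Sum>m=3..N. (m - 2) * k m) < N - 1}. f k) = 1 + (\<Sum>k\<in>eta_set N. f k)"
proof -
  let ?E = "{k \<in> PiE {3..N} (\<lambda>_. UNIV). (\<Sum>m=3..N. (m - 2) * k m) < N - 1}"
  have "bij_betw (\<lambda>k. restrict k {3..N}) (insert (\<lambda>_. 0) (eta_set N)) ?E"
  proof (rule bij_betw_byWitness[where f'="\<lambda>k m. if m \<in> {3..N} then k m else 0"])
    show "\<forall>a\<in>insert (\<lambda>_. 0) (eta_set N). (\<lambda>m. if m \<in> {3..N} then restrict a {3..N} m else 0) = a"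
      by (auto simp: eta_set_def fun_eq_iff)
    show "\<forall>k\<in>?E. restrict (\<lambda>m. if m \<in> {3..N} then k m else 0) {3..N} = k"
      by (auto simp: fun_eq_iff PiE_iff extensional_def)
    show "(\<lambda>k. restrict k {3..N}) ` insert (\<lambda>_. 0) (eta_set N) \<subseteq> ?E"
      using N by (auto simp: eta_set_def)
    show "(\<lambda>k m. if m \<in> {3..N} then k m else 0) ` ?E \<subseteq> insert (\<lambda>_. 0) (eta_set N)"
    proof (rule image_subsetI)
      fix k assume k: "k \<in> ?E"
      show "(\<lambda>m. if m \<in> {3..N} then k m else 0) \<in> insert (\<lambda>_. 0) (eta_set N)"
      proof (cases "(\<Sum>m=3..N. (m - 2) * k m) = 0")
        case True
        then have "\<forall>m\<in>{3..N}. k m = 0" by (auto simp: sum_eq_0_iff)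
        then show ?thesis by (auto simp: fun_eq_iff)
      next
        case False
        then have "1 \<le> (\<Sum>m=3..N. (m - 2) * k m)" by linarith
        then show ?thesis using k by (auto simp: eta_set_def)
      qed
    qed
  qed
  from sum.reindex_bij_betw[OF this, of f, symmetric]
  have "(\<Sum>k\<in>?E. f k) = (\<Sum>k\<in>insert (\<lambda>_. 0) (eta_set N). f k)" by (simp add: f)
  also have "\<dots> = 1 + (\<Sum>k\<in>eta_set N. f k)"
    by (subst sum.insert) (auto simp: finite_eta_set f0, auto simp: eta_set_def)
  finally show ?thesis .
qed

section \<open>Characteristic functions of weighted gamma series\<close>

lemma power_split_square:
  fixes x :: "'c :: monoid_mult"
  assumes "m \<ge> 2"
  shows "x ^ m = x ^ (m - 2) * x\<^sup>2"
  using assms by (metis le_add_diff_inverse2 power_add)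

text \<open>The tail starts at index N + 1 \<ge> 3, which gives 1/3 from the denominators and 3/2
  from the geometric series with ratio at most 1/3, together 1/2.\<close>

lemma Ln_one_minus_remainder:
  fixes z :: complex
  assumes z: "norm z \<le> 1 / 3" and N: "N \<ge> 2"
  shows "norm (- Ln (1 - z) - z - (\<Sum>k=2..N. z ^ k / of_nat k)) \<le> norm z ^ (N + 1) / 2"
proof -
  let ?f = "\<lambda>n. z ^ n / of_nat n"
  have s: "?f sums (- Ln (1 - z))"
    using sums_minus[OF Ln_series'[of "- z"]] z by simp
  \<comment> \<open>The term of index 0 is 1 / 0 = 0, so it may be included in the sum.\<close>
  have "(\<Sum>n<N+1. ?f n) = (\<Sum>n\<in>{0,1} \<union> {2..N}. ?f n)"
    using N by (intro sum.cong) auto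
  also have "\<dots> = z + (\<Sum>k=2..N. ?f k)"
    by (subst sum.union_disjoint) auto
  finally have head: "(\<Sum>n<N+1. ?f n) = z + (\<Sum>k=2..N. ?f k)" .
  from s have s': "(\<lambda>n. ?f (n + (N + 1))) sums (- Ln (1 - z) - z - (\<Sum>k=2..N. ?f k))"
    by (subst sums_iff_shift) (simp only: head diff_diff_eq diff_add_cancel)
  have g: "(\<lambda>n. norm z ^ (N + 1) / 3 * norm z ^ n) sums (norm z ^ (N + 1) / 3 * (1 / (1 - norm z)))"
    using z by (intro sums_mult geometric_sums) auto
  have le: "norm (?f (n + (N + 1))) \<le> norm z ^ (N + 1) / 3 * norm z ^ n" for n
  proof -
    have "norm (?f (n + (N + 1))) = norm z ^ (n + (N + 1)) / real (n + (N + 1))"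
      unfolding norm_divide norm_power norm_of_nat ..
    also have "\<dots> \<le> norm z ^ (n + (N + 1)) / 3" using N by (intro divide_left_mono) auto
    finally show ?thesis by (simp add: power_add mult_ac)
  qed
  have "norm (- Ln (1 - z) - z - (\<Sum>k=2..N. ?f k)) \<le> norm z ^ (N + 1) / 3 * (1 / (1 - norm z))"
    using norm_sums_le[OF s' g le] .
  also have "1 / (1 - norm z) \<le> 3 / 2" using z by (simp add: field_simps)
  then have "norm z ^ (N + 1) / 3 * (1 / (1 - norm z)) \<le> norm z ^ (N + 1) / 3 * (3 / 2)"
    by (intro mult_left_mono) auto
  finally show ?thesis by simp
qed

lemma norm_exp_add_minus_exp:
  fixes A R :: complex
  shows "norm (exp (A + R) - exp A) \<le> norm R * exp (norm A + norm R)"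
proof -
  have "exp (A + R) - exp A = exp A * (exp R - 1)" by (simp add: exp_add algebra_simps)
  then have "norm (exp (A + R) - exp A) = norm (exp A) * norm (exp R - 1)" by (simp add: norm_mult)
  also have "\<dots> \<le> exp (norm A) * (norm R * exp (norm R))"
  proof (rule mult_mono)
    show "norm (exp A) \<le> exp (norm A)" by (rule norm_exp)
    have "norm (exp R - exp 0) \<le> exp (norm R) * norm (R - 0)"
    proof (rule field_differentiable_bound[where S="cball 0 (norm R)" and f'=exp])
      show "norm (exp z) \<le> exp (norm R)" if "z \<in> cball 0 (norm R)" for z :: complex
        using that norm_exp[of z] by (auto intro: order_trans)
    qed (auto intro!: derivative_eq_intros)
    then show "norm (exp R - 1) \<le> norm R * exp (norm R)" by (simp add: mult.commute)
  qed auto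
  finally show ?thesis by (simp add: exp_add mult_ac)
qed

text \<open>Replacing m by 3 in the denominator leaves t^2 / 9 times a geometric series of ratio
  1/3, whose sum is at most 3/2.\<close>

lemma sum_cubic_weights_le: "(\<Sum>m=3..N. t\<^sup>2 / (3 ^ (m - 2) * real m)) \<le> t\<^sup>2 / 6"
proof -
  have "(\<Sum>m=3..N. t\<^sup>2 / (3 ^ (m - 2) * real m)) \<le> (\<Sum>m=3..N. t\<^sup>2 / 9 * (1 / 3) ^ (m - 3))"
  proof (rule sum_mono)
    fix m assume m: "m \<in> {3..N}"
    then have "m - 2 = Suc (m - 3)" by auto
    then have "(3 :: real) ^ (m - 2) = 3 * 3 ^ (m - 3)" by simp
    moreover have "t\<^sup>2 / (3 * 3 ^ (m - 3) * real m) \<le> t\<^sup>2 / (3 * 3 ^ (m - 3) * 3)"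
      using m by (intro divide_left_mono mult_left_mono) auto
    ultimately show "t\<^sup>2 / (3 ^ (m - 2) * real m) \<le> t\<^sup>2 / 9 * (1 / 3) ^ (m - 3)"
      by (simp add: power_one_over field_simps)
  qed
  also have "\<dots> = t\<^sup>2 / 9 * (\<Sum>m=3..N. (1 / 3) ^ (m - 3))" by (simp add: sum_distrib_left)
  also have "(\<Sum>m=3..N. (1 / 3 :: real) ^ (m - 3)) = (\<Sum>m<N-2. (1 / 3) ^ m)"
    by (rule sum.reindex_bij_witness[where i="\<lambda>m. m + 3" and j="\<lambda>m. m - 3"]) auto
  also have "\<dots> \<le> 3 / 2" unfolding sum_gp_strict by simp
  finally show ?thesis by (simp add: mult_left_mono)
qed

text \<open>Normalized weights with variance 1 and maximum at most \<open>\<epsilon>\<close>, with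
  no reference to the order or the regular variation of the sequence. All estimates below are
  explicit in \<open>\<epsilon>\<close>, hence uniform over such sequences.\<close>

locale gamma_weights =
  fixes r \<epsilon> :: real and a :: "nat \<Rightarrow> real"
  assumes r: "r > 0" and eps: "\<epsilon> > 0"
    and a_nonneg: "\<And>n. a n \<ge> 0" and a_le: "\<And>n. a n \<le> \<epsilon>"
    and a_sums: "(\<lambda>n. r * (a n)\<^sup>2) sums 1"
begin

text \<open>The cumulant of order m divided by m!: the sum of the independent variables r * a n *
  (\<open>\<eta>\<close> - 1) has m-th cumulant (m - 1)! * (\<Sum>n. r * a n ^ m).\<close>

definition coef :: "nat \<Rightarrow> real" where "coef m = (\<Sum>n. r * a n ^ m) / real m"

lemma power_le: "m \<ge> 2 \<Longrightarrow> r * a n ^ m \<le> \<epsilon> ^ (m - 2) * (r * (a n)\<^sup>2)"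
proof -
  assume "m \<ge> 2"
  then have "a n ^ m = a n ^ (m - 2) * (a n)\<^sup>2" by (rule power_split_square)
  also have "\<dots> \<le> \<epsilon> ^ (m - 2) * (a n)\<^sup>2" by (intro mult_right_mono power_mono a_le a_nonneg) auto
  finally show ?thesis using r by (simp add: mult_ac)
qed

lemma power_summable: "m \<ge> 2 \<Longrightarrow> summable (\<lambda>n. r * a n ^ m)"
  by (rule summable_comparison_test'[where N=0, OF summable_mult[OF sums_summable[OF a_sums], of "\<epsilon> ^ (m - 2)"]])
     (use r a_nonneg power_le in auto)

lemma coef_nonneg: "m \<ge> 2 \<Longrightarrow> coef m \<ge> 0"
  unfolding coef_def using power_summable r a_nonneg by (intro divide_nonneg_nonneg suminf_nonneg) auto

lemma coef_le: "m \<ge> 2 \<Longrightarrow> coef m \<le> \<epsilon> ^ (m - 2) / real m"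
proof -
  assume m: "m \<ge> 2"
  have "(\<Sum>n. r * a n ^ m) \<le> (\<Sum>n. \<epsilon> ^ (m - 2) * (r * (a n)\<^sup>2))"
    using m by (intro suminf_le power_le power_summable summable_mult sums_summable[OF a_sums])
  also have "\<dots> = \<epsilon> ^ (m - 2)" using sums_unique[OF sums_mult[OF a_sums, of "\<epsilon> ^ (m - 2)"]] by simp
  finally show ?thesis unfolding coef_def by (intro divide_right_mono) auto
qed

text \<open>Multiplied by exp (- t^2 / 2) this is the Fourier transform belonging to the expansion,
  each power \<open>Suc (zeta N k)\<close> standing for one Hermite term. It is also the part of
  weight below N - 1 of the exponential of the cumulant terms, which is how it gets
  estimated.\<close>

definition edge_poly :: "nat \<Rightarrow> real \<Rightarrow> complex" where
  "edge_poly N t = 1 + (\<Sum>k\<in>eta_set N. of_real (\<Prod>m=3..N. 1 / fact (k m) * coef m ^ k m) * (\<i> * of_real t) ^ Suc (zeta N k))"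

lemma edge_poly_eq:
  assumes "N \<ge> 2"
  shows "edge_poly N t = (\<Sum>k\<in>{k \<in> PiE {3..N} (\<lambda>_. UNIV). (\<Sum>m=3..N. (m - 2) * k m) < N - 1}.
      \<Prod>m=3..N. (of_real (coef m) * (\<i> * of_real t) ^ m) ^ k m / fact (k m))"
proof -
  let ?y = "\<lambda>m. of_real (coef m) * (\<i> * of_real t) ^ m"
  have "(\<Prod>m=3..N. ?y m ^ k m / fact (k m)) = of_real (\<Prod>m=3..N. 1 / fact (k m) * coef m ^ k m) * (\<i> * of_real t) ^ Suc (zeta N k)"
    if "k \<in> eta_set N" for k
    by (simp add: zeta_Suc[OF that] power_sum power_mult_distrib prod.distrib prod_dividef power_mult)
  then show ?thesis unfolding edge_poly_def
    by (subst sum_eta_set_PiE[OF assms]) (auto intro!: sum.cong prod.cong)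
qed

lemma edge_poly_bounds:
  assumes N: "N \<ge> 2"
  shows edge_poly_central: "3 * \<epsilon> * \<bar>t\<bar> \<le> 1 \<Longrightarrow>
      norm (exp (\<Sum>m=3..N. of_real (coef m) * (\<i> * of_real t) ^ m) - edge_poly N t) \<le> (3 * \<epsilon> * \<bar>t\<bar>) ^ (N - 1) * exp (t\<^sup>2 / 6)"
    and edge_poly_outer: "3 * \<epsilon> * \<bar>t\<bar> \<ge> 1 \<Longrightarrow> norm (edge_poly N t) \<le> (3 * \<epsilon> * \<bar>t\<bar>) ^ (N - 1) * exp (t\<^sup>2 / 6)"
    and sum_coef_le: "3 * \<epsilon> * \<bar>t\<bar> \<le> 1 \<Longrightarrow> norm (\<Sum>m=3..N. of_real (coef m) * (\<i> * of_real t) ^ m) \<le> t\<^sup>2 / 6"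
proof -
  let ?y = "\<lambda>m. of_real (coef m) * (\<i> * of_real t) ^ m"
  \<comment> \<open>The power of 3 moved into q is paid back in the denominators of z, which makes
    the exponential of the sum of the z small against the Gaussian.\<close>
  let ?q = "3 * \<epsilon> * \<bar>t\<bar>" and ?z = "\<lambda>m. t\<^sup>2 / (3 ^ (m - 2) * real m)"
  have q: "?q \<ge> 0" using eps by simp
  have y: "norm (?y m) \<le> ?q ^ (m - 2) * ?z m" if "m \<in> {3..N}" for m
  proof -
    have "norm (?y m) = coef m * \<bar>t\<bar> ^ m" using that coef_nonneg[of m] by (simp add: norm_mult norm_power)
    also have "\<dots> \<le> \<epsilon> ^ (m - 2) / real m * \<bar>t\<bar> ^ m" using that coef_le[of m] by (intro mult_right_mono) auto
    also have "\<bar>t\<bar> ^ m = \<bar>t\<bar> ^ (m - 2) * t\<^sup>2" using that power_split_square[of m "\<bar>t\<bar>"] by simp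
    also have "\<epsilon> ^ (m - 2) / real m * (\<bar>t\<bar> ^ (m - 2) * t\<^sup>2) = ?q ^ (m - 2) * ?z m"
      by (simp add: power_mult_distrib field_simps)
    finally show ?thesis .
  qed
  have E: "exp (\<Sum>m=3..N. ?z m) \<le> exp (t\<^sup>2 / 6)" using sum_cubic_weights_le[of t N] by simp
  then have E': "?q ^ (N - 1) * exp (\<Sum>m=3..N. ?z m) \<le> ?q ^ (N - 1) * exp (t\<^sup>2 / 6)"
    using q by (intro mult_left_mono) auto
  show "norm (exp (\<Sum>m=3..N. ?y m) - edge_poly N t) \<le> ?q ^ (N - 1) * exp (t\<^sup>2 / 6)" if "?q \<le> 1"
    unfolding edge_poly_eq[OF N]
    by (rule order_trans[OF exp_truncation_le[OF _ _ q y _ that] E']) auto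
  show "norm (edge_poly N t) \<le> ?q ^ (N - 1) * exp (t\<^sup>2 / 6)" if "?q \<ge> 1"
    unfolding edge_poly_eq[OF N]
    by (rule order_trans[OF exp_truncation_ge[OF _ _ q y _ that] E']) auto
  show "norm (\<Sum>m=3..N. ?y m) \<le> t\<^sup>2 / 6" if "?q \<le> 1"
  proof (rule order_trans[OF sum_norm_le sum_cubic_weights_le[of t N]])
    fix m assume m: "m \<in> {3..N}"
    have "?q ^ (m - 2) * ?z m \<le> 1 * ?z m" using that q by (intro mult_right_mono power_le_one) auto
    with y[OF m] show "norm (?y m) \<le> ?z m" by simp
  qed
qed

text \<open>A logarithm of the characteristic function of r * a n * (\<open>\<eta>\<close> - 1); the
  subtracted linear term is the centring.\<close>

definition log_term :: "real \<Rightarrow> nat \<Rightarrow> complex" where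
  "log_term t n = of_real r * (- Ln (1 - \<i> * of_real (t * a n)) - \<i> * of_real (t * a n))"

lemma log_term_sums:
  assumes N: "N \<ge> 2" and t: "3 * \<epsilon> * \<bar>t\<bar> \<le> 1"
  obtains R where "log_term t sums (- of_real (t\<^sup>2 / 2) + (\<Sum>m=3..N. of_real (coef m) * (\<i> * of_real t) ^ m) + R)"
    and "norm R \<le> (\<epsilon> * \<bar>t\<bar>) ^ (N - 1) * t\<^sup>2 / 2"
proof -
  let ?z = "\<lambda>n. \<i> * complex_of_real (t * a n)"
  define R where "R n = - Ln (1 - ?z n) - ?z n - (\<Sum>k=2..N. ?z n ^ k / of_nat k)" for n
  have nz: "norm (?z n) = \<bar>t\<bar> * a n" for n using a_nonneg[of n] by (simp add: norm_mult abs_mult)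
  have nz3: "norm (?z n) \<le> 1 / 3" for n
  proof -
    have "\<bar>t\<bar> * a n \<le> \<bar>t\<bar> * \<epsilon>" by (intro mult_left_mono a_le) auto
    then show ?thesis using t unfolding nz by (simp add: mult_ac)
  qed
  have R_le: "norm (of_real r * R n) \<le> \<bar>t\<bar> ^ (N + 1) / 2 * (r * a n ^ (N + 1))" for n
  proof -
    have "norm (R n) \<le> norm (?z n) ^ (N + 1) / 2"
      unfolding R_def using nz3 N by (rule Ln_one_minus_remainder)
    then have "r * norm (R n) \<le> r * ((\<bar>t\<bar> * a n) ^ (N + 1) / 2)" unfolding nz using r by (intro mult_left_mono) auto
    then show ?thesis using r by (simp only: norm_mult norm_of_real abs_of_pos power_mult_distrib mult_ac times_divide_eq_right times_divide_eq_left)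
  qed
  have sN: "summable (\<lambda>n. r * a n ^ (N + 1))" using N by (intro power_summable) auto
  have sR: "summable (\<lambda>n. of_real r * R n)"
    by (rule summable_comparison_test'[where N=0, OF summable_mult[OF sN, of "\<bar>t\<bar> ^ (N + 1) / 2"]]) (rule R_le)
  have pw: "(\<lambda>n. of_real r * (?z n ^ m / of_nat m)) sums (of_real (coef m) * (\<i> * of_real t) ^ m)" if "m \<ge> 2" for m
  proof -
    have "(\<lambda>n. r * a n ^ m / real m) sums coef m"
      unfolding coef_def using that by (intro sums_divide summable_sums power_summable)
    from sums_mult2[OF sums_of_real[OF this], of "(\<i> * of_real t) ^ m"]
    show ?thesis by (simp add: power_mult_distrib mult_ac)
  qed
  \<comment> \<open>The variance normalization turns the quadratic term into - t^2 / 2, the Gaussian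
    factor.\<close>
  have c2: "coef 2 = 1 / 2" unfolding coef_def using sums_unique[OF a_sums] by simp
  have "(\<lambda>n. (\<Sum>m=2..N. of_real r * (?z n ^ m / of_nat m)) + of_real r * R n) sums
      ((\<Sum>m=2..N. of_real (coef m) * (\<i> * of_real t) ^ m) + (\<Sum>n. of_real r * R n))"
    by (intro sums_add sums_sum pw summable_sums sR) auto
  also have "(\<lambda>n. (\<Sum>m=2..N. of_real r * (?z n ^ m / of_nat m)) + of_real r * R n) = log_term t"
    by (simp add: fun_eq_iff log_term_def R_def sum_distrib_left right_diff_distrib)
  also have "(\<Sum>m=2..N. of_real (coef m) * (\<i> * of_real t) ^ m) = - of_real (t\<^sup>2 / 2) + (\<Sum>m=3..N. of_real (coef m) * (\<i> * of_real t) ^ m)"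
    using N by (subst sum.atLeast_Suc_atMost) (auto simp: c2 power_mult_distrib)
  finally have 1: "log_term t sums (- of_real (t\<^sup>2 / 2) + (\<Sum>m=3..N. of_real (coef m) * (\<i> * of_real t) ^ m) + (\<Sum>n. of_real r * R n))" .
  have "norm (\<Sum>n. of_real r * R n) \<le> (\<Sum>n. \<bar>t\<bar> ^ (N + 1) / 2 * (\<epsilon> ^ (N - 1) * (r * (a n)\<^sup>2)))"
  proof (rule norm_suminf_le)
    fix n
    have "norm (of_real r * R n) \<le> \<bar>t\<bar> ^ (N + 1) / 2 * (r * a n ^ (N + 1))" by (rule R_le)
    also have "\<dots> \<le> \<bar>t\<bar> ^ (N + 1) / 2 * (\<epsilon> ^ (N + 1 - 2) * (r * (a n)\<^sup>2))"
      using N by (intro mult_left_mono power_le) auto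
    finally show "norm (of_real r * R n) \<le> \<bar>t\<bar> ^ (N + 1) / 2 * (\<epsilon> ^ (N - 1) * (r * (a n)\<^sup>2))" by simp
  qed (intro summable_mult sums_summable[OF a_sums])
  also have "\<dots> = \<bar>t\<bar> ^ (N + 1) / 2 * (\<epsilon> ^ (N - 1) * 1)"
    by (intro sums_unique[symmetric] sums_mult a_sums)
  also have "\<bar>t\<bar> ^ (N + 1) = \<bar>t\<bar> ^ (N - 1) * t\<^sup>2" using N power_split_square[of "N + 1" "\<bar>t\<bar>"] by simp
  finally have 2: "norm (\<Sum>n. of_real r * R n) \<le> (\<epsilon> * \<bar>t\<bar>) ^ (N - 1) * t\<^sup>2 / 2"
    by (simp add: power_mult_distrib mult_ac)
  show ?thesis by (rule that[OF 1 2])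
qed

lemma char_limit_central:
  assumes N: "N \<ge> 2" and t: "3 * \<epsilon> * \<bar>t\<bar> \<le> 1"
    and lim: "(\<lambda>n. \<Prod>i<n. exp (log_term t i)) \<longlonglongrightarrow> \<psi>"
  shows "norm (\<psi> - of_real (exp (- t\<^sup>2 / 2)) * edge_poly N t) \<le> (3 * \<epsilon> * \<bar>t\<bar>) ^ (N - 1) * ((1 + t\<^sup>2) * exp (- t\<^sup>2 / 6))"
proof -
  let ?A = "\<Sum>m=3..N. of_real (coef m) * (\<i> * of_real t) ^ m"
  let ?G = "exp (- t\<^sup>2 / 2)" and ?q = "3 * \<epsilon> * \<bar>t\<bar>"
  obtain R where R: "log_term t sums (- of_real (t\<^sup>2 / 2) + ?A + R)"
    and R_le: "norm R \<le> (\<epsilon> * \<bar>t\<bar>) ^ (N - 1) * t\<^sup>2 / 2"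
    by (rule log_term_sums[OF N t])
  have "(\<lambda>n. exp (\<Sum>i<n. log_term t i)) \<longlonglongrightarrow> exp (- of_real (t\<^sup>2 / 2) + ?A + R)"
    using R unfolding sums_def by (rule tendsto_exp)
  with lim have "\<psi> = exp (- of_real (t\<^sup>2 / 2) + ?A + R)"
    by (simp add: exp_sum LIMSEQ_unique)
  also have "- of_real (t\<^sup>2 / 2) + ?A + R = complex_of_real (- t\<^sup>2 / 2) + (?A + R)" by simp
  also have "exp \<dots> = of_real ?G * exp (?A + R)"
    by (simp only: exp_add[of "complex_of_real (- t\<^sup>2 / 2)"] exp_of_real)
  finally have psi: "\<psi> - of_real ?G * edge_poly N t = of_real ?G * ((exp (?A + R) - exp ?A) + (exp ?A - edge_poly N t))"
    by (simp add: algebra_simps)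
  have q0: "0 \<le> \<epsilon> * \<bar>t\<bar>" using eps by simp
  \<comment> \<open>As N \<ge> 2, one factor \<open>\<epsilon>\<close> |t| \<le> 1/3 is available;
    with the 1/2 in the bound for R it yields t^2 / 6.\<close>
  have "(\<epsilon> * \<bar>t\<bar>) ^ (N - 1) \<le> (\<epsilon> * \<bar>t\<bar>) ^ 1"
    using t q0 N by (intro power_decreasing) auto
  then have "(\<epsilon> * \<bar>t\<bar>) ^ (N - 1) \<le> 1 / 3" using t by simp
  then have "(\<epsilon> * \<bar>t\<bar>) ^ (N - 1) * t\<^sup>2 \<le> 1 / 3 * t\<^sup>2" by (rule mult_right_mono) simp
  with R_le have R6: "norm R \<le> t\<^sup>2 / 6" by simp
  have "(\<epsilon> * \<bar>t\<bar>) ^ (N - 1) \<le> ?q ^ (N - 1)" using q0 by (intro power_mono) auto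
  then have "(\<epsilon> * \<bar>t\<bar>) ^ (N - 1) * t\<^sup>2 \<le> ?q ^ (N - 1) * t\<^sup>2" by (rule mult_right_mono) simp
  with R_le have R_q: "norm R \<le> ?q ^ (N - 1) * t\<^sup>2" using norm_ge_zero[of R] by linarith
  have "norm (exp (?A + R) - exp ?A) \<le> norm R * exp (norm ?A + norm R)" by (rule norm_exp_add_minus_exp)
  also have "\<dots> \<le> (?q ^ (N - 1) * t\<^sup>2) * exp (t\<^sup>2 / 3)"
    using R_q R6 sum_coef_le[OF N t] eps by (intro mult_mono) auto
  finally have 1: "norm (exp (?A + R) - exp ?A) \<le> (?q ^ (N - 1) * t\<^sup>2) * exp (t\<^sup>2 / 3)" .
  have "norm (exp ?A - edge_poly N t) \<le> ?q ^ (N - 1) * exp (t\<^sup>2 / 6)" by (rule edge_poly_central[OF N t])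
  also have "\<dots> \<le> ?q ^ (N - 1) * exp (t\<^sup>2 / 3)" using eps by (intro mult_left_mono) auto
  finally have 2: "norm (exp ?A - edge_poly N t) \<le> ?q ^ (N - 1) * exp (t\<^sup>2 / 3)" .
  have "norm ((exp (?A + R) - exp ?A) + (exp ?A - edge_poly N t)) \<le> (?q ^ (N - 1) * t\<^sup>2) * exp (t\<^sup>2 / 3) + ?q ^ (N - 1) * exp (t\<^sup>2 / 3)"
    by (rule order_trans[OF norm_triangle_ineq add_mono[OF 1 2]])
  then have "norm (\<psi> - of_real ?G * edge_poly N t) \<le> ?G * ((?q ^ (N - 1) * t\<^sup>2) * exp (t\<^sup>2 / 3) + ?q ^ (N - 1) * exp (t\<^sup>2 / 3))"
    unfolding psi norm_mult norm_of_real by (simp only: abs_exp_cancel) (rule mult_left_mono, auto)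
  also have "\<dots> = ?q ^ (N - 1) * ((1 + t\<^sup>2) * (?G * exp (t\<^sup>2 / 3)))" by (simp only: algebra_simps)
  also have "?G * exp (t\<^sup>2 / 3) = exp (- t\<^sup>2 / 6)" by (simp flip: exp_add)
  finally show ?thesis .
qed

lemma norm_exp_log_term: "norm (exp (log_term t n)) = (1 + (t * a n)\<^sup>2) powr (- r / 2)"
proof -
  have pos: "0 < 1 + (t * a n)\<^sup>2" by (rule add_pos_nonneg) auto
  have nz: "1 - \<i> * of_real (t * a n) \<noteq> 0" by (auto simp: complex_eq_iff)
  have "norm (1 - \<i> * of_real (t * a n)) = sqrt (1 + (t * a n)\<^sup>2)"
    by (simp add: cmod_def)
  then have "Re (log_term t n) = - r * ln (sqrt (1 + (t * a n)\<^sup>2))"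
    using nz by (simp add: log_term_def)
  also have "\<dots> = - r / 2 * ln (1 + (t * a n)\<^sup>2)" using pos by (simp add: ln_sqrt)
  finally show ?thesis using pos by (simp add: powr_def)
qed

text \<open>Only the K comparable factors are kept, the others having modulus at most 1. One full
  power of 1 + (c \<open>\<epsilon>\<close> t)^2 is set aside for integrability in t, which needs r
  K \<ge> 2; the remaining power is evaluated at the threshold, where (c \<open>\<epsilon>\<close>
  t)^2 \<ge> c^2 / 9.\<close>

lemma char_limit_outer:
  assumes c: "c > 0" and K: "\<And>n. n < K \<Longrightarrow> c * \<epsilon> \<le> a n" "r * real K \<ge> 2" and t: "3 * \<epsilon> * \<bar>t\<bar> \<ge> 1"
    and lim: "(\<lambda>n. \<Prod>i<n. exp (log_term t i)) \<longlonglongrightarrow> \<psi>"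
  shows "norm \<psi> \<le> (1 + c\<^sup>2 / 9) powr (1 - r * real K / 2) / (1 + (c * \<epsilon> * t)\<^sup>2)"
proof -
  let ?s = "1 + (c * \<epsilon> * t)\<^sup>2"
  have s0: "?s > 0" by (rule add_pos_nonneg) auto
  have le1: "norm (exp (log_term t i)) \<le> 1" for i
    unfolding norm_exp_log_term using r powr_mono[of "- r / 2" 0 "1 + (t * a i)\<^sup>2"] by (simp add: add_nonneg_eq_0_iff)
  have leK: "norm (exp (log_term t i)) \<le> ?s powr (- r / 2)" if "i < K" for i
  proof -
    have "c * \<epsilon> * \<bar>t\<bar> \<le> a i * \<bar>t\<bar>" using K(1)[OF that] by (intro mult_right_mono) auto
    then have "(c * \<epsilon> * \<bar>t\<bar>)\<^sup>2 \<le> (a i * \<bar>t\<bar>)\<^sup>2" using c eps by (intro power_mono) auto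
    then have "?s \<le> 1 + (t * a i)\<^sup>2" by (simp add: power_mult_distrib mult_ac)
    then show ?thesis unfolding norm_exp_log_term using r s0 by (intro powr_mono2') auto
  qed
  have "norm (\<Prod>i<n. exp (log_term t i)) \<le> ?s powr (- r * real K / 2)" if "n \<ge> K" for n
  proof -
    have "norm (\<Prod>i<n. exp (log_term t i)) = (\<Prod>i<n. norm (exp (log_term t i)))" by (rule prod_norm[symmetric])
    also have "\<dots> \<le> (\<Prod>i<n. if i < K then ?s powr (- r / 2) else 1)"
      using le1 leK by (intro prod_mono) auto
    also have "\<dots> = (\<Prod>i<K. ?s powr (- r / 2))"
      using that by (intro prod.mono_neutral_cong_right) auto
    also have "\<dots> = ?s powr (- r * real K / 2)"
      using s0 by (simp add: powr_powr flip: powr_realpow)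
    finally show ?thesis .
  qed
  then have "norm \<psi> \<le> ?s powr (- r * real K / 2)"
    using tendsto_norm[OF lim] by (intro LIMSEQ_le_const2) auto
  also have "\<dots> = ?s powr (1 - r * real K / 2) / ?s"
  proof -
    have "y powr (- x) = y powr (1 - x) / y" if "y > 0" for x y :: real
      using that powr_add[of y 1 "- x"] by simp
    from this[OF s0, of "r * real K / 2"] show ?thesis by simp
  qed
  also have "\<dots> \<le> (1 + c\<^sup>2 / 9) powr (1 - r * real K / 2) / ?s"
  proof (intro divide_right_mono powr_mono2')
    have "(c / 3 * 1)\<^sup>2 \<le> (c / 3 * (3 * \<epsilon> * \<bar>t\<bar>))\<^sup>2" using c t by (intro power_mono mult_left_mono) auto
    then show "1 + c\<^sup>2 / 9 \<le> ?s" by (simp add: power_mult_distrib power_divide)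
    show "0 < 1 + c\<^sup>2 / 9" by (rule add_pos_nonneg) auto
  qed (use K in auto)
  finally show ?thesis .
qed

text \<open>The bound must keep a factor |t| to pay for the later division. The central term has one
  because N - 1 \<ge> 1, leaving the exponent N - 2. In the outer range the factor 3
  \<open>\<epsilon>\<close> |t| \<ge> 1 is inserted; its \<open>\<epsilon>\<close> is exactly what
  keeps the integral of the Cauchy term bounded as \<open>\<epsilon>\<close> tends to 0.\<close>

lemma char_limit_bound:
  fixes c :: real and K N :: nat
  defines "g \<equiv> \<lambda>t. (3 * \<epsilon>) ^ (N - 1) * (\<bar>t\<bar> ^ (N - 2) * ((1 + t\<^sup>2) * exp (- t\<^sup>2 / 6))) +
      3 * (1 + c\<^sup>2 / 9) powr (1 - r * real K / 2) * (\<epsilon> / (1 + (c * \<epsilon> * t)\<^sup>2))"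
  assumes N: "N \<ge> 2" and c: "c > 0" and K: "\<And>n. n < K \<Longrightarrow> c * \<epsilon> \<le> a n" "r * real K \<ge> 2"
    and lim: "(\<lambda>n. \<Prod>i<n. exp (log_term t i)) \<longlonglongrightarrow> \<psi>"
  shows "norm (\<psi> - of_real (exp (- t\<^sup>2 / 2)) * edge_poly N t) \<le> \<bar>t\<bar> * g t"
proof -
  let ?Q = "(1 + c\<^sup>2 / 9) powr (1 - r * real K / 2)" and ?q = "3 * \<epsilon> * \<bar>t\<bar>"
  let ?D = "1 + (c * \<epsilon> * t)\<^sup>2"
  have D: "?D > 0" by (rule add_pos_nonneg) auto
  have "N - 1 = Suc (N - 2)" using N by auto
  then have eq: "\<bar>t\<bar> * g t = ?q ^ (N - 1) * ((1 + t\<^sup>2) * exp (- t\<^sup>2 / 6)) + ?q * (?Q / ?D)"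
    unfolding g_def power_mult_distrib by (simp add: algebra_simps)
  show ?thesis
  proof (cases "?q \<le> 1")
    case True
    have "0 \<le> ?q * (?Q / ?D)" using eps D by simp
    with char_limit_central[OF N True lim] show ?thesis unfolding eq by linarith
  next
    case False
    then have q: "?q \<ge> 1" by simp
    have "norm \<psi> \<le> ?Q / ?D" by (rule char_limit_outer[OF c K q lim])
    also have "\<dots> \<le> ?q * (?Q / ?D)" using mult_right_mono[OF q, of "?Q / ?D"] D by simp
    finally have 1: "norm \<psi> \<le> ?q * (?Q / ?D)" .
    have "norm (of_real (exp (- t\<^sup>2 / 2)) * edge_poly N t) \<le> exp (- t\<^sup>2 / 2) * (?q ^ (N - 1) * exp (t\<^sup>2 / 6))"
      using edge_poly_outer[OF N q] by (simp add: norm_mult)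
    also have "\<dots> = ?q ^ (N - 1) * exp (- t\<^sup>2 / 3)" by (simp add: field_simps flip: exp_add)
    also have "\<dots> \<le> ?q ^ (N - 1) * ((1 + t\<^sup>2) * exp (- t\<^sup>2 / 6))"
    proof (intro mult_left_mono)
      have "exp (- t\<^sup>2 / 3) \<le> 1 * exp (- t\<^sup>2 / 6)" by simp
      also have "\<dots> \<le> (1 + t\<^sup>2) * exp (- t\<^sup>2 / 6)" by (intro mult_right_mono) auto
      finally show "exp (- t\<^sup>2 / 3) \<le> (1 + t\<^sup>2) * exp (- t\<^sup>2 / 6)" .
    qed (use q in auto)
    finally have "norm (of_real (exp (- t\<^sup>2 / 2)) * edge_poly N t) \<le> ?q ^ (N - 1) * ((1 + t\<^sup>2) * exp (- t\<^sup>2 / 6))" .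
    with 1 show ?thesis unfolding eq
      using norm_triangle_ineq4[of \<psi> "of_real (exp (- t\<^sup>2 / 2)) * edge_poly N t"] by linarith
  qed
qed

end

section \<open>The Edgeworth expansion\<close>

lemma gauss_envelope_integrable: "integrable lborel (\<lambda>t::real. \<bar>t\<bar> ^ k * ((1 + t\<^sup>2) * exp (- t\<^sup>2 / 6)))"
proof -
  have mom: "integrable lborel (\<lambda>t::real. exp (- t\<^sup>2 / 6) * \<bar>t\<bar> ^ k)" for k
  proof -
    \<comment> \<open>Up to its normalization, exp (- t^2 / 6) is the normal density of variance
      3.\<close>
    have "integrable lborel (\<lambda>t. sqrt (2 * pi * 3) * (normal_density 0 (sqrt 3) t * \<bar>t - 0\<bar> ^ k))"
      by (intro integrable_mult_right integrable_normal_moment_abs) simp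
    moreover have "sqrt (2 * pi * 3) * (normal_density 0 (sqrt 3) t * \<bar>t - 0\<bar> ^ k) = exp (- t\<^sup>2 / 6) * \<bar>t\<bar> ^ k" for t
      by (simp add: normal_density_def)
    ultimately show ?thesis by (simp only:)
  qed
  have "\<bar>t\<bar> ^ k * ((1 + t\<^sup>2) * exp (- t\<^sup>2 / 6)) = exp (- t\<^sup>2 / 6) * \<bar>t\<bar> ^ k + exp (- t\<^sup>2 / 6) * \<bar>t\<bar> ^ (k + 2)" for t :: real
    unfolding power_add power2_abs by (simp add: algebra_simps)
  then show ?thesis by (simp only: Bochner_Integration.integrable_add mom)
qed

text \<open>The substitution x = c e t removes e from the value, so the outer contribution depends
  on the weights only through c and the exponential factor.\<close>

lemma cauchy_envelope_integral:
  fixes c e :: real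
  assumes "c > 0" "e > 0"
  shows cauchy_envelope_integrable: "integrable lborel (\<lambda>t. e / (1 + (c * e * t)\<^sup>2))"
    and "(LINT t|lborel. e / (1 + (c * e * t)\<^sup>2)) = pi / c"
proof -
  have ce: "c * e \<noteq> 0" using assms by simp
  have i: "integrable lborel (\<lambda>x::real. inverse (1 + x\<^sup>2))"
    using integrable_inverse_1_plus_square by (simp add: set_integrable_def)
  have "(LINT x|lborel. inverse (1 + x\<^sup>2)) = pi"
    using LBINT_inverse_1_plus_square by (simp add: interval_lebesgue_integral_def set_lebesgue_integral_def)
  then have v: "c * e * (LINT t|lborel. inverse (1 + (c * e * t)\<^sup>2)) = pi"
    using lborel_integral_real_affine[OF ce, of "\<lambda>x. inverse (1 + x\<^sup>2)" 0] assms by simp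
  have eq: "e / (1 + (c * e * t)\<^sup>2) = e * inverse (1 + (c * e * t)\<^sup>2)" for t by (simp add: divide_inverse)
  have "integrable lborel (\<lambda>t. inverse (1 + (0 + c * e * t)\<^sup>2))"
    using lborel_integrable_real_affine[OF i ce, of 0] .
  then show "integrable lborel (\<lambda>t. e / (1 + (c * e * t)\<^sup>2))" unfolding eq by (intro integrable_mult_right) simp
  show "(LINT t|lborel. e / (1 + (c * e * t)\<^sup>2)) = pi / c"
    unfolding eq integral_mult_right_zero using v assms by (simp add: field_simps)
qed

lemma (in prob_space) char_distr_affine:
  assumes [measurable]: "X \<in> borel_measurable M"
  shows "char (distr M borel (\<lambda>\<omega>. \<alpha> * X \<omega> + \<beta>)) t = iexp (t * \<beta>) * char (distr M borel X) (t * \<alpha>)"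
proof -
  have "char (distr M borel (\<lambda>\<omega>. \<alpha> * X \<omega> + \<beta>)) t = (LINT \<omega>|M. iexp (t * (\<alpha> * X \<omega> + \<beta>)))"
    unfolding char_def by (rule integral_distr) auto
  also have "\<dots> = (LINT \<omega>|M. iexp (t * \<beta>) * iexp (t * \<alpha> * X \<omega>))"
    by (intro Bochner_Integration.integral_cong refl) (simp add: algebra_simps flip: exp_add)
  also have "\<dots> = iexp (t * \<beta>) * (LINT \<omega>|M. iexp (t * \<alpha> * X \<omega>))"
    by (rule integral_mult_right_zero)
  also have "(LINT \<omega>|M. iexp (t * \<alpha> * X \<omega>)) = char (distr M borel X) (t * \<alpha>)"
    unfolding char_def by (rule integral_distr[symmetric]) auto
  finally show ?thesis .
qed

text \<open>Almost sure convergence of the partial sums passes to the characteristic functions by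
  dominated convergence with the constant 1.\<close>

lemma (in prob_space) char_distr_suminf:
  fixes X :: "nat \<Rightarrow> 'a \<Rightarrow> real"
  assumes indep: "indep_vars (\<lambda>_. borel) X UNIV"
    and Y: "AE \<omega> in M. (\<lambda>n. X n \<omega>) sums Y \<omega>" and [measurable]: "Y \<in> borel_measurable M"
  shows "(\<lambda>n. \<Prod>i<n. char (distr M borel (X i)) t) \<longlonglongrightarrow> char (distr M borel Y) t"
proof -
  have [measurable]: "X i \<in> borel_measurable M" for i using indep by (auto simp: indep_vars_def)
  have "(\<Prod>i<n. char (distr M borel (X i)) t) = (LINT \<omega>|M. iexp (t * (\<Sum>i<n. X i \<omega>)))" for n
  proof -
    have "(\<Prod>i<n. char (distr M borel (X i)) t) = char (distr M borel (\<lambda>\<omega>. \<Sum>i<n. X i \<omega>)) t"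
      by (rule char_distr_sum[symmetric]) (rule indep_vars_subset[OF indep], auto)
    also have "\<dots> = (LINT \<omega>|M. iexp (t * (\<Sum>i<n. X i \<omega>)))"
      unfolding char_def by (rule integral_distr) auto
    finally show ?thesis .
  qed
  moreover have "char (distr M borel Y) t = (LINT \<omega>|M. iexp (t * Y \<omega>))"
    unfolding char_def by (rule integral_distr) auto
  moreover have "(\<lambda>n. LINT \<omega>|M. iexp (t * (\<Sum>i<n. X i \<omega>))) \<longlonglongrightarrow> (LINT \<omega>|M. iexp (t * Y \<omega>))"
  proof (rule integral_dominated_convergence[where w="\<lambda>_. 1"])
    show "AE \<omega> in M. (\<lambda>n. iexp (t * (\<Sum>i<n. X i \<omega>))) \<longlonglongrightarrow> iexp (t * Y \<omega>)"
      using Y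
    proof eventually_elim
      case (elim \<omega>)
      then show ?case unfolding sums_def by (intro tendsto_intros)
    qed
  qed (auto simp del: of_real_mult of_real_sum)
  ultimately show ?thesis by simp
qed

text \<open>Slow variation is used for the ratio 2 only. The quotient of the \<open>l\<close> values
  tends to 1 and so eventually exceeds 1/2, the source of the division by 2 in the constant.\<close>

lemma doubling_of_slowly_varying:
  fixes l :: "real \<Rightarrow> real" and lam :: "nat \<Rightarrow> real"
  assumes l: "slowly_varying l" and lam: "\<And>n. n \<ge> 1 \<Longrightarrow> lam n = l (real n) * real n powr (- \<gamma>)"
    and pos: "\<And>n. n \<ge> 1 \<Longrightarrow> lam n > 0"
  shows "\<forall>\<^sub>F n in sequentially. 2 powr (- \<gamma>) / 2 * lam n \<le> lam (2 * n)"
proof -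
  have "((\<lambda>x. l (2 * x) / l x) \<longlongrightarrow> 1) at_top" using l by (simp add: slowly_varying_def)
  then have "((\<lambda>n. l (2 * real n) / l (real n)) \<longlonglongrightarrow> 1)"
    by (rule filterlim_compose[OF _ filterlim_real_sequentially])
  then have "\<forall>\<^sub>F n in sequentially. 1 / 2 < l (2 * real n) / l (real n)"
    by (rule order_tendstoD) simp
  then show ?thesis using eventually_ge_at_top[of 1]
  proof eventually_elim
    case (elim n)
    have "l (real n) > 0" using pos[of n] lam[of n] elim by (simp add: zero_less_mult_iff)
    then have "1 / 2 * l (real n) \<le> l (2 * real n)" using elim by (simp add: field_simps)
    then have "1 / 2 * l (real n) * (2 powr (- \<gamma>) * real n powr (- \<gamma>)) \<le> l (2 * real n) * (2 powr (- \<gamma>) * real n powr (- \<gamma>))"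
      by (rule mult_right_mono) simp
    also have "\<dots> = lam (2 * n)" using lam[of "2 * n"] elim by (simp add: powr_mult)
    finally show ?case using lam[of n] elim by (simp add: mult_ac)
  qed
qed

text \<open>With weights divided by r \<open>sigma\<close>, the product r * a n ^ m carries the
  factor 1 / (r ^ (m - 1) * \<open>sigma\<close> ^ m) of \<open>kappa\<close>, and (m - 1)! / m! = 1
  / m is the denominator in \<open>coef\<close>.\<close>

lemma kappa_eq_coef:
  assumes "gamma_weights r \<epsilon> (\<lambda>n. lam (n + M) / (r * sigma r lam M))"
    and s: "sigma r lam M > 0" and m: "m \<ge> 2"
  shows "kappa r lam m M / fact m = gamma_weights.coef r (\<lambda>n. lam (n + M) / (r * sigma r lam M)) m"
proof -
  interpret gamma_weights r \<epsilon> "\<lambda>n. lam (n + M) / (r * sigma r lam M)" by (rule assms)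
  let ?s = "sigma r lam M"
  obtain j where j: "m = Suc j" using m by (cases m) auto
  have eq: "r * (lam (n + M) / (r * ?s)) ^ m = 1 / (r ^ j * ?s ^ m) * lam (n + M) ^ m" for n
    using r s by (simp add: j field_simps)
  have "summable (\<lambda>n. (r ^ j * ?s ^ m) * (r * (lam (n + M) / (r * ?s)) ^ m))"
    by (rule summable_mult[OF power_summable[OF m]])
  then have "summable (\<lambda>n. lam (n + M) ^ m)" unfolding eq using r s by simp
  then have sum_eq: "(\<Sum>n. r * (lam (n + M) / (r * ?s)) ^ m) = 1 / (r ^ j * ?s ^ m) * (\<Sum>n. lam (n + M) ^ m)"
    unfolding eq by (rule suminf_mult)
  have "fact (m - 1) / A * S / fact m = 1 / A * S / real m" for A S :: real
    using m by (simp add: fact_reduce)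
  then show ?thesis unfolding coef_def kappa_def sum_eq by (simp only: j diff_Suc_1)
qed

context prob_space
begin

lemma gamma_series_char:
  fixes \<eta> :: "nat \<Rightarrow> 'a \<Rightarrow> real" and lam :: "nat \<Rightarrow> real" and r \<epsilon> :: real and k :: nat
  assumes indep: "indep_vars (\<lambda>_. borel) \<eta> {1..}"
    and dens: "\<And>n. n \<ge> 1 \<Longrightarrow> distributed M lborel (\<eta> n) (\<lambda>x. ennreal (gamma_dens r x))"
    and k: "k \<ge> 1"
    and w: "gamma_weights r \<epsilon> (\<lambda>n. lam (n + k) / (r * sigma r lam k))"
    and s: "sigma r lam k > 0"
  shows "Ytil r lam \<eta> k \<in> borel_measurable M"
    and "(\<lambda>n. \<Prod>i<n. exp (gamma_weights.log_term r (\<lambda>n. lam (n + k) / (r * sigma r lam k)) t i))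
       \<longlonglongrightarrow> char (distr M borel (Ytil r lam \<eta> k)) t"
proof -
  interpret w: gamma_weights r \<epsilon> "\<lambda>n. lam (n + k) / (r * sigma r lam k)" by (rule w)
  let ?s = "sigma r lam k"
  define X where "X n \<omega> = lam (n + k) / ?s * \<eta> (n + k) \<omega> + (- (lam (n + k) / ?s))" for n \<omega>
  have eta_meas[measurable]: "\<eta> (n + k) \<in> borel_measurable M" for n
    using indep k by (auto simp: indep_vars_def)
  have D: "distributed M lborel (\<eta> (n + k)) (\<lambda>x. ennreal (gamma_dens r x))" for n
    using k by (intro dens) auto
  show meas: "Ytil r lam \<eta> k \<in> borel_measurable M"
    unfolding Ytil_def[abs_def] by measurable
  have X_eq: "X n \<omega> = lam (n + k) * (\<eta> (n + k) \<omega> - 1) / ?s" for n \<omega>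
    by (simp add: X_def field_simps diff_divide_distrib)
  have "indep_vars (\<lambda>_. borel) (\<lambda>n. \<eta> (n + k)) UNIV"
    using k by (intro indep_vars_shift[OF indep]) auto
  then have X_indep: "indep_vars (\<lambda>_. borel) X UNIV"
    unfolding X_def[abs_def] by (rule indep_vars_compose2) auto
  have int1: "integrable M (\<eta> (n + k))" for n
    using gamma_distributed_integrable[OF w.r D, of n 1] by simp
  have int2: "integrable M (\<lambda>\<omega>. (\<eta> (n + k) \<omega> - 1)\<^sup>2)" for n
  proof -
    have "integrable M (\<lambda>\<omega>. (\<eta> (n + k) \<omega>)\<^sup>2 - 2 * \<eta> (n + k) \<omega> + 1)"
      using gamma_distributed_integrable[OF w.r D, of n 2] int1 by simp
    then show ?thesis by (simp add: power2_diff algebra_simps)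
  qed
  have X_sq: "(X n \<omega>)\<^sup>2 = (lam (n + k) / ?s)\<^sup>2 * (\<eta> (n + k) \<omega> - 1)\<^sup>2" for n \<omega>
    unfolding X_eq by (simp add: power_mult_distrib power_divide)
  have X_var: "expectation (\<lambda>\<omega>. (X n \<omega>)\<^sup>2) = r * (lam (n + k) / (r * ?s))\<^sup>2" for n
    unfolding X_sq integral_mult_right_zero gamma_distributed_variance[OF w.r D]
    using w.r by (simp add: power2_eq_square)
  \<comment> \<open>\<open>Ytil\<close> is a \<open>suminf\<close> and thus defined everywhere; it
    is the sum of the series only where that converges, which Kolmogorov's theorem provides almost
    surely.\<close>
  have "AE \<omega> in M. summable (\<lambda>n. X n \<omega>)"
  proof (rule kolmogorov_summable_AE[OF X_indep])
    show "integrable M (\<lambda>\<omega>. (X n \<omega>)\<^sup>2)" for n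
      unfolding X_sq by (intro integrable_mult_right int2)
    show "expectation (X n) = 0" for n
      unfolding X_def using int1[of n] gamma_distributed_mean[OF w.r D] by (simp add: prob_space)
    show "summable (\<lambda>n. expectation (\<lambda>\<omega>. (X n \<omega>)\<^sup>2))"
      unfolding X_var by (rule sums_summable[OF w.a_sums])
  qed
  then have "AE \<omega> in M. (\<lambda>n. X n \<omega>) sums Ytil r lam \<eta> k \<omega>"
  proof eventually_elim
    case (elim \<omega>)
    then have "summable (\<lambda>n. ?s * X n \<omega>)" by (rule summable_mult)
    then have "summable (\<lambda>n. lam (n + k) * (\<eta> (n + k) \<omega> - 1))" using s by (simp add: X_eq)
    from sums_divide[OF summable_sums[OF this], of ?s] show ?case by (simp add: X_eq Ytil_def)
  qed
  from char_distr_suminf[OF X_indep this meas, of t]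
  have lim: "(\<lambda>n. \<Prod>i<n. char (distr M borel (X i)) t) \<longlonglongrightarrow> char (distr M borel (Ytil r lam \<eta> k)) t" .
  have "char (distr M borel (X i)) t = exp (w.log_term t i)" for i
  proof -
    let ?\<alpha> = "lam (i + k) / ?s"
    have "char (distr M borel (X i)) t = iexp (t * (- ?\<alpha>)) * exp (- of_real r * Ln (1 - \<i> * of_real (t * ?\<alpha> / r)))"
      unfolding X_def char_distr_affine[OF eta_meas] gamma_distributed_char[OF w.r D] ..
    also have "\<dots> = exp (\<i> * of_real (t * (- ?\<alpha>)) + - of_real r * Ln (1 - \<i> * of_real (t * ?\<alpha> / r)))"
      by (rule exp_add[symmetric])
    also have "\<i> * of_real (t * (- ?\<alpha>)) + - of_real r * Ln (1 - \<i> * of_real (t * ?\<alpha> / r)) = w.log_term t i"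
      using w.r by (simp add: w.log_term_def field_simps)
    finally show ?thesis .
  qed
  with lim show "(\<lambda>n. \<Prod>i<n. exp (w.log_term t i)) \<longlonglongrightarrow> char (distr M borel (Ytil r lam \<eta> k)) t"
    by simp
qed

text \<open>A bound for one fixed tail: the two summands are the integrals of the two envelopes in
  \<open>char_limit_bound\<close>. For given r, N and c, the tail enters only through
  \<open>\<epsilon>\<close> and the number K of comparable weights.\<close>

lemma gamma_series_edgeworth:
  fixes \<eta> :: "nat \<Rightarrow> 'a \<Rightarrow> real" and lam :: "nat \<Rightarrow> real" and r \<epsilon> c :: real and k K :: nat
  assumes indep: "indep_vars (\<lambda>_. borel) \<eta> {1..}"
    and dens: "\<And>n. n \<ge> 1 \<Longrightarrow> distributed M lborel (\<eta> n) (\<lambda>x. ennreal (gamma_dens r x))"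
    and k: "k \<ge> 1"
    and w: "gamma_weights r \<epsilon> (\<lambda>n. lam (n + k) / (r * sigma r lam k))"
    and s: "sigma r lam k > 0" and N: "N \<ge> 2" and c: "c > 0"
    and K: "\<And>n. n < K \<Longrightarrow> c * \<epsilon> \<le> lam (n + k) / (r * sigma r lam k)" "r * real K \<ge> 2"
  shows "\<bar>prob {\<omega> \<in> space M. Ytil r lam \<eta> k \<omega> \<le> x} - edgeworth r lam N k x\<bar>
     \<le> ((3 * \<epsilon>) ^ (N - 1) * (LINT t|lborel. \<bar>t\<bar> ^ (N - 2) * ((1 + t\<^sup>2) * exp (- t\<^sup>2 / 6))) +
         3 * (1 + c\<^sup>2 / 9) powr (1 - r * real K / 2) * (pi / c)) / pi"
proof -
  interpret w: gamma_weights r \<epsilon> "\<lambda>n. lam (n + k) / (r * sigma r lam k)" by (rule w)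
  note char = gamma_series_char[OF indep dens k w s]
  have meas[measurable]: "Ytil r lam \<eta> k \<in> borel_measurable M" by (rule char(1))
  interpret Y: real_distribution "distr M borel (Ytil r lam \<eta> k)"
    by (rule real_distribution_distr) simp
  let ?Q = "(1 + c\<^sup>2 / 9) powr (1 - r * real K / 2)"
  let ?h = "\<lambda>t::real. \<bar>t\<bar> ^ (N - 2) * ((1 + t\<^sup>2) * exp (- t\<^sup>2 / 6))"
  let ?g = "\<lambda>t::real. (3 * \<epsilon>) ^ (N - 1) * ?h t + 3 * ?Q * (\<epsilon> / (1 + (c * \<epsilon> * t)\<^sup>2))"
  let ?c = "\<lambda>k'. \<Prod>m=3..N. (1 / fact (k' m)) * (kappa r lam m k / fact m) ^ k' m"
  have i1: "integrable lborel (\<lambda>t. (3 * \<epsilon>) ^ (N - 1) * ?h t)"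
    by (intro integrable_mult_right gauss_envelope_integrable)
  have i2: "integrable lborel (\<lambda>t. 3 * ?Q * (\<epsilon> / (1 + (c * \<epsilon> * t)\<^sup>2)))"
    by (intro integrable_mult_right cauchy_envelope_integrable c w.eps)
  have "\<bar>cdf (distr M borel (Ytil r lam \<eta> k)) x - (Phi x - phi x * (\<Sum>k'\<in>eta_set N. ?c k' * hermite (zeta N k') x))\<bar>
      \<le> (LINT t|lborel. ?g t) / pi"
  proof (rule Y.smoothing_inequality)
    show "integrable lborel ?g" by (rule Bochner_Integration.integrable_add[OF i1 i2])
    show "?g t \<ge> 0" for t using w.eps by (intro add_nonneg_nonneg mult_nonneg_nonneg divide_nonneg_nonneg) auto
    fix t :: real
    have "kappa r lam m k / fact m = w.coef m" if "m \<in> {3..N}" for m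
      using that by (intro kappa_eq_coef[OF w s]) auto
    then have "1 + (\<Sum>k'\<in>eta_set N. of_real (?c k') * (\<i> * of_real t) ^ Suc (zeta N k')) = w.edge_poly N t"
      unfolding w.edge_poly_def by simp
    with w.char_limit_bound[OF N c K char(2)[of t]]
    show "norm (char (distr M borel (Ytil r lam \<eta> k)) t - of_real (exp (- t\<^sup>2 / 2)) *
        (1 + (\<Sum>k'\<in>eta_set N. of_real (?c k') * (\<i> * of_real t) ^ Suc (zeta N k')))) \<le> \<bar>t\<bar> * ?g t"
      by (simp only:)
  qed
  also have "(LINT t|lborel. ?g t) = (3 * \<epsilon>) ^ (N - 1) * (LINT t|lborel. ?h t) + 3 * ?Q * (pi / c)"
    unfolding Bochner_Integration.integral_add[OF i1 i2] integral_mult_right_zero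
      cauchy_envelope_integral(2)[OF c w.eps] ..
  also have "cdf (distr M borel (Ytil r lam \<eta> k)) x = prob {\<omega> \<in> space M. Ytil r lam \<eta> k \<omega> \<le> x}"
    unfolding cdf_def by (subst measure_distr) (auto intro!: arg_cong[where f=prob])
  finally show ?thesis unfolding edgeworth_def .
qed

end

theorem theorem5p2:
  fixes \<Omega> :: "'a measure" and \<eta> :: "nat \<Rightarrow> 'a \<Rightarrow> real"
    and r \<gamma> :: real and l :: "real \<Rightarrow> real" and lam :: "nat \<Rightarrow> real" and N :: nat
  assumes "prob_space \<Omega>"
    and "r > 0"
    and "prob_space.indep_vars \<Omega> (\<lambda>_. borel) \<eta> {1..}"
    and "\<And>n. n \<ge> 1 \<Longrightarrow> distributed \<Omega> lborel (\<eta> n) (\<lambda>x. ennreal (gamma_dens r x))"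
    and "\<gamma> > 1/2" and "slowly_varying l"
    and "\<And>n. n \<ge> 1 \<Longrightarrow> lam n = l (real n) * real n powr (- \<gamma>)"
    and "\<And>n. n \<ge> 1 \<Longrightarrow> lam n > 0"
    and "\<And>n m. 1 \<le> n \<Longrightarrow> n \<le> m \<Longrightarrow> lam m \<le> lam n"
    and "(\<lambda>n. (lam (Suc n))\<^sup>2) sums r"
    and "N \<ge> 2"
  shows "\<exists>C M0. \<forall>M\<ge>M0. \<forall>x::real.
           \<bar>prob_space.prob \<Omega> {\<omega> \<in> space \<Omega>. Ytil r lam \<eta> M \<omega> \<le> x} - edgeworth r lam N M x\<bar>
             \<le> C * real M powr (- (real N - 1) / 2)"
proof -
  interpret prob_space \<Omega> by (rule assms)
  note r = assms(2) and pos = assms(8) and dec = assms(9) and N = assms(11)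
  define c where "c = 2 powr (- \<gamma>) / 2"
  have c: "c > 0" by (simp add: c_def)
  define H where "H = (LINT t|lborel. \<bar>t\<bar> ^ (N - 2) * ((1 + t\<^sup>2) * exp (- t\<^sup>2 / 6)) :: real)"
  have H: "H \<ge> 0" unfolding H_def by (intro Bochner_Integration.integral_nonneg) auto
  define b where "b = 1 + c\<^sup>2 / 9"
  have b: "b > 1" using c by (simp add: b_def)
  define p where "p = (real N - 1) / 2"
  \<comment> \<open>Geometric decay in M beats any power, so the outer contribution is eventually
    below M powr - p.\<close>
  have "((\<lambda>M::nat. b powr (1 - r * real M / 2) * real M powr p) \<longlongrightarrow> 0) at_top"
    using b r by real_asymp
  then have "\<forall>\<^sub>F M in sequentially. b powr (1 - r * real M / 2) * real M powr p < 1"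
    by (rule order_tendstoD) simp
  moreover have "\<forall>\<^sub>F M in sequentially. r * real M \<ge> 2"
    using r by real_asymp
  moreover have "\<forall>\<^sub>F M in sequentially. c * lam M \<le> lam (2 * M)"
    unfolding c_def using assms(6-8) by (rule doubling_of_slowly_varying)
  moreover have "\<forall>\<^sub>F M::nat in sequentially. M \<ge> 1" by (rule eventually_ge_at_top)
  ultimately have "\<forall>\<^sub>F M in sequentially. \<forall>x.
      \<bar>prob {\<omega> \<in> space \<Omega>. Ytil r lam \<eta> M \<omega> \<le> x} - edgeworth r lam N M x\<bar>
       \<le> ((3 / (c * sqrt r)) ^ (N - 1) * H + 3 * (pi / c)) / pi * real M powr (- (real N - 1) / 2)"
  proof eventually_elim
    case (elim M)
    let ?s = "sigma r lam M"
    define a where "a n = lam (n + M) / (r * ?s)" for n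
    have sm: "summable (\<lambda>n. (lam (n + M))\<^sup>2)"
    proof -
      \<comment> \<open>The given series starts at index 1, so the tail from M \<ge> 1 is its shift
        by M - 1.\<close>
      have "summable (\<lambda>n. (lam (Suc (n + (M - 1))))\<^sup>2)"
        by (rule summable_ignore_initial_segment[OF sums_summable[OF assms(10)]])
      then show ?thesis using elim by simp
    qed
    have lp: "lam (n + M) > 0" for n using elim by (intro pos) auto
    have "(\<Sum>n. (lam (n + M))\<^sup>2) > 0" by (intro suminf_pos[OF sm] zero_less_power lp)
    then have s2: "sigma2 r lam M > 0" using r by (simp add: sigma2_def)
    then have s: "?s > 0" by (simp add: sigma_def)
    have as: "(\<lambda>n. r * (a n)\<^sup>2) sums 1"
    proof -
      have "(\<lambda>n. 1 / (r * ?s\<^sup>2) * (lam (n + M))\<^sup>2) sums (1 / (r * ?s\<^sup>2) * (\<Sum>n. (lam (n + M))\<^sup>2))"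
        by (intro sums_mult summable_sums sm)
      also have "1 / (r * ?s\<^sup>2) * (\<Sum>n. (lam (n + M))\<^sup>2) = sigma2 r lam M / ?s\<^sup>2" by (simp add: sigma2_def)
      also have "\<dots> = 1" using s2 by (simp add: sigma_def)
      finally show ?thesis using r by (simp add: a_def power_divide power_mult_distrib power2_eq_square mult_ac)
    qed
    have a_pos: "a n > 0" for n using lp r s by (simp add: a_def)
    have w: "gamma_weights r (a 0) a"
    proof
      show "a n \<le> a 0" for n unfolding a_def using elim dec[of M "n + M"] r s by (intro divide_right_mono) auto
    qed (use r as a_pos less_imp_le in auto)
    interpret w: gamma_weights r "a 0" a by (rule w)
    \<comment> \<open>The indices n + M with n < M stay below 2 M, so monotonicity and the doubling
      bound make M weights comparable to the largest one; K is taken to be M.\<close>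
    have K: "c * a 0 \<le> a n" if "n < M" for n
    proof -
      have "c * lam M \<le> lam (2 * M)" using elim by simp
      also have "\<dots> \<le> lam (n + M)" using that by (intro dec) auto
      finally show ?thesis using r s by (simp add: a_def divide_right_mono)
    qed
    \<comment> \<open>M squares of size at least (c * a 0)^2 fit into a sum of total 1, which forces
      \<open>a 0\<close> to be of order 1 / sqrt M.\<close>
    have "(\<Sum>n<M. r * (c * a 0)\<^sup>2) \<le> (\<Sum>n<M. r * (a n)\<^sup>2)"
      using K c a_pos[of 0] r by (intro sum_mono mult_left_mono power_mono) auto
    also have "\<dots> \<le> (\<Sum>n. r * (a n)\<^sup>2)"
      by (rule sum_le_suminf[OF sums_summable[OF as]]) (use r in auto)
    also have "\<dots> = 1" by (rule sums_unique[OF as, symmetric])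
    finally have "real M * (r * (c * a 0)\<^sup>2) \<le> 1" by simp
    moreover have "(c * sqrt r * sqrt (real M) * a 0)\<^sup>2 = real M * (r * (c * a 0)\<^sup>2)"
      unfolding power_mult_distrib using r by simp
    ultimately have "(c * sqrt r * sqrt (real M) * a 0)\<^sup>2 \<le> 1\<^sup>2" by (simp only: power_one)
    then have "c * sqrt r * sqrt (real M) * a 0 \<le> 1" by (rule power2_le_imp_le) simp
    moreover have crM: "c * sqrt r * sqrt (real M) > 0" using c r elim by simp
    ultimately have "a 0 \<le> 1 / (c * sqrt r * sqrt (real M))" by (simp add: field_simps)
    also have "\<dots> = 1 / (c * sqrt r) * real M powr (- 1 / 2)"
    proof -
      have "real M powr (- 1 / 2) = 1 / sqrt (real M)"
        using powr_minus_divide[of "real M" "1 / 2"] powr_half_sqrt[of "real M"] by simp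
      then show ?thesis by (simp only: times_divide_times_eq mult_1_left)
    qed
    finally have "(3 * a 0) ^ (N - 1) \<le> (3 / (c * sqrt r) * real M powr (- 1 / 2)) ^ (N - 1)"
      using a_pos[of 0] by (intro power_mono) auto
    also have "\<dots> = (3 / (c * sqrt r)) ^ (N - 1) * real M powr (- p)"
    proof -
      have "(real M powr (- 1 / 2)) ^ (N - 1) = real M powr (- 1 / 2 * real (N - 1))"
        using elim by (subst powr_power) (auto simp: mult.commute)
      also have "- 1 / 2 * real (N - 1) = - p" using N by (simp add: p_def of_nat_diff)
      finally show ?thesis by (simp only: power_mult_distrib)
    qed
    finally have eps: "(3 * a 0) ^ (N - 1) \<le> (3 / (c * sqrt r)) ^ (N - 1) * real M powr (- p)" .
    have "b powr (1 - r * real M / 2) * real M powr p * real M powr (- p) \<le> 1 * real M powr (- p)"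
      using elim by (intro mult_right_mono) auto
    then have Q: "b powr (1 - r * real M / 2) \<le> real M powr (- p)"
      using elim by (simp add: mult.assoc flip: powr_add)
    show ?case
    proof
      fix x
      have "\<bar>prob {\<omega> \<in> space \<Omega>. Ytil r lam \<eta> M \<omega> \<le> x} - edgeworth r lam N M x\<bar>
          \<le> ((3 * a 0) ^ (N - 1) * H + 3 * b powr (1 - r * real M / 2) * (pi / c)) / pi"
        unfolding H_def b_def
      proof (rule gamma_series_edgeworth[OF assms(3,4)])
        show "gamma_weights r (a 0) (\<lambda>n. lam (n + M) / (r * sigma r lam M))" using w unfolding a_def[abs_def] .
        show "c * a 0 \<le> lam (n + M) / (r * sigma r lam M)" if "n < M" for n
          using K[OF that] by (simp only: a_def)
      qed (use elim s N c in auto)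
      also have "\<dots> \<le> ((3 / (c * sqrt r)) ^ (N - 1) * real M powr (- p) * H + 3 * real M powr (- p) * (pi / c)) / pi"
        using eps Q c H by (intro divide_right_mono add_mono mult_right_mono mult_left_mono) auto
      also have "\<dots> = ((3 / (c * sqrt r)) ^ (N - 1) * H + 3 * (pi / c)) / pi * real M powr (- p)"
        by (simp add: algebra_simps)
      also have "- p = - (real N - 1) / 2" unfolding p_def by (rule minus_divide_left)
      finally show "\<bar>prob {\<omega> \<in> space \<Omega>. Ytil r lam \<eta> M \<omega> \<le> x} - edgeworth r lam N M x\<bar>
          \<le> ((3 / (c * sqrt r)) ^ (N - 1) * H + 3 * (pi / c)) / pi * real M powr (- (real N - 1) / 2)" .
    qed
  qed
  then obtain M0 where "\<forall>M\<ge>M0. \<forall>x.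
      \<bar>prob {\<omega> \<in> space \<Omega>. Ytil r lam \<eta> M \<omega> \<le> x} - edgeworth r lam N M x\<bar>
       \<le> ((3 / (c * sqrt r)) ^ (N - 1) * H + 3 * (pi / c)) / pi * real M powr (- (real N - 1) / 2)"
    unfolding eventually_sequentially by blast
  then show ?thesis by blast
qed

end
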